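(* Let $S$ and $\Sigma$ be two measurable subsets of $\mathbb{R}$. The following assertions are equivalent: 1. $(S,\Sigma)$ is an annihilating pair; 2. $1+i\notin W(P_S+iP_\Sigma)$; 3. $\mathrm{Ran}(P_S)\cap\mathrm{Ran}(P_\Sigma)=\{0\}$; 4. $1\notin W(P_SP_\Sigma)$.
   Context: Let $\mathcal{F}$ be the (unitary) Fourier transform on $L_2(\mathbb{R})$. For $g\in L_\infty(\mathbb{R})$, $M_g$ is the operator of multiplication by $g$ on $L_2(\mathbb{R})$, and $\mathbf{1}_S$ is the indicator function of $S$. Set $P_S=M_{\mathbf{1}_S}$ and $P_\Sigma=\mathcal{F}^*M_{\mathbf{1}_\Sigma}\mathcal{F}$, which are orthogonal projections on $L_2(\mathbb{R})$. The pair $(S,\Sigma)$ is an annihilating pair if for every $f\in L_2(\mathbb{R})$, $P_Sf=P_\Sigma f=f$ implies $f=0$. For a bounded operator $T$, $W(T)=\{\langle Tx,x\rangle : \|x\|=1\}$ is its numerical range and $\mathrm{Ran}(T)$ its range. *)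

theory Defs
  imports "HOL-Analysis.Analysis"
begin

definition square_integrable :: "(real \<Rightarrow> complex) \<Rightarrow> bool" where
  "square_integrable f \<longleftrightarrow>
     f \<in> borel_measurable lebesgue \<and> integrable lebesgue (\<lambda>x. (cmod (f x))\<^sup>2)"

lemma square_integrable_zero: "square_integrable (\<lambda>_. 0)"
  by (simp add: square_integrable_def)

lemma square_integrable_mult_bounded:
  assumes "square_integrable f" "g \<in> borel_measurable lebesgue"
    and "AE x in lebesgue. cmod (g x) \<le> C"
  shows "square_integrable (\<lambda>x. g x * f x)"
proof -
  have m[measurable]: "f \<in> borel_measurable lebesgue" "g \<in> borel_measurable lebesgue"
    using assms by (auto simp: square_integrable_def)
  have i: "integrable lebesgue (\<lambda>x. C\<^sup>2 * (cmod (f x))\<^sup>2)"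
    using assms by (auto simp: square_integrable_def)
  have "integrable lebesgue (\<lambda>x. (cmod (g x * f x))\<^sup>2)"
  proof (rule Bochner_Integration.integrable_bound[OF i])
    show "AE x in lebesgue. norm ((cmod (g x * f x))\<^sup>2) \<le> norm (C\<^sup>2 * (cmod (f x))\<^sup>2)"
      using assms(3)
      by eventually_elim
        (auto simp: norm_mult power_mult_distrib intro!: mult_right_mono power_mono)
  qed measurable
  then show ?thesis by (simp add: square_integrable_def)
qed

lemma square_integrable_add:
  assumes "square_integrable f" "square_integrable g"
  shows "square_integrable (\<lambda>x. f x + g x)"
proof -
  have m[measurable]: "f \<in> borel_measurable lebesgue" "g \<in> borel_measurable lebesgue"
    using assms by (auto simp: square_integrable_def)
  have i: "integrable lebesgue (\<lambda>x. 2 * (cmod (f x))\<^sup>2 + 2 * (cmod (g x))\<^sup>2)"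
    using assms by (auto simp: square_integrable_def)
  have le: "(cmod (a + b))\<^sup>2 \<le> 2 * (cmod a)\<^sup>2 + 2 * (cmod b)\<^sup>2" for a b :: complex
  proof -
    have "(cmod (a + b))\<^sup>2 \<le> (cmod a + cmod b)\<^sup>2"
      by (intro power_mono norm_triangle_ineq) auto
    also have "\<dots> \<le> 2 * (cmod a)\<^sup>2 + 2 * (cmod b)\<^sup>2"
      using zero_le_power2[of "cmod a - cmod b"] by (simp add: power2_eq_square algebra_simps)
    finally show ?thesis .
  qed
  have "integrable lebesgue (\<lambda>x. (cmod (f x + g x))\<^sup>2)"
    by (rule Bochner_Integration.integrable_bound[OF i]) (use le in auto)
  then show ?thesis by (simp add: square_integrable_def)
qed

lemma square_integrable_scale:
  assumes "square_integrable f" shows "square_integrable (\<lambda>x. c * f x)"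
  by (rule square_integrable_mult_bounded[OF assms, where C = "cmod c"]) auto

lemma square_integrable_prod:
  assumes "square_integrable f" "square_integrable g"
  shows "integrable lebesgue (\<lambda>x. f x * cnj (g x))"
proof -
  have m[measurable]: "f \<in> borel_measurable lebesgue" "g \<in> borel_measurable lebesgue"
    using assms by (auto simp: square_integrable_def)
  have i: "integrable lebesgue (\<lambda>x. (cmod (f x))\<^sup>2 + (cmod (g x))\<^sup>2)"
    using assms by (auto simp: square_integrable_def)
  have le: "cmod (a * cnj b) \<le> (cmod a)\<^sup>2 + (cmod b)\<^sup>2" for a b :: complex
  proof -
    have "2 * (cmod a * cmod b) \<le> (cmod a)\<^sup>2 + (cmod b)\<^sup>2"
      using sum_squares_bound[of "cmod a" "cmod b"] by simp
    moreover have "0 \<le> cmod a * cmod b" by simp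
    ultimately show ?thesis by (simp add: norm_mult del: zero_le_mult_iff mult_nonneg_nonneg)
  qed
  have c: "(\<lambda>x. cnj (g x)) \<in> borel_measurable lebesgue"
    by (rule measurable_compose[OF m(2)]) (intro borel_measurable_continuous_onI continuous_intros)
  have "(\<lambda>x. f x * cnj (g x)) \<in> borel_measurable lebesgue"
    using c by measurable
  then show ?thesis
    by (intro Bochner_Integration.integrable_bound[OF i]) (use le in auto)
qed

quotient_type L2 = "real \<Rightarrow> complex" / partial:
  "\<lambda>f g. square_integrable f \<and> square_integrable g \<and> (AE x in lebesgue. f x = g x)"
proof (rule part_equivpI)
  show "\<exists>f. square_integrable f \<and> square_integrable f \<and> (AE x in lebesgue. f x = f x)"
    using square_integrable_zero by auto
  show "symp (\<lambda>f g. square_integrable f \<and> square_integrable g \<and> (AE x in lebesgue. f x = g x))"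
    by (auto simp: symp_def elim: eventually_mono)
  show "transp (\<lambda>f g. square_integrable f \<and> square_integrable g \<and> (AE x in lebesgue. f x = g x))"
  proof (rule transpI, intro conjI; (elim conjE)?)
    fix f g h :: "real \<Rightarrow> complex"
    assume "AE x in lebesgue. f x = g x" "AE x in lebesgue. g x = h x"
    then show "AE x in lebesgue. f x = h x" by eventually_elim simp
  qed auto
qed

text \<open>Complex linear in the first argument. The library has real inner product spaces only, so the
  \<open>real_inner\<close> instance below uses its real part; this gives the usual norm and topology.\<close>

lift_definition L2_cinner :: "L2 \<Rightarrow> L2 \<Rightarrow> complex" is
  "\<lambda>f g. LINT x|lebesgue. f x * cnj (g x)"
proof (elim conjE)
  fix f f' g g'
  assume sq: "square_integrable f" "square_integrable f'" "square_integrable g" "square_integrable g'"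
    and ae: "AE x in lebesgue. f x = f' x" "AE x in lebesgue. g x = g' x"
  have "AE x in lebesgue. f x * cnj (g x) = f' x * cnj (g' x)"
    using ae by eventually_elim simp
  then show "(LINT x|lebesgue. f x * cnj (g x)) = (LINT x|lebesgue. f' x * cnj (g' x))"
    by (intro integral_cong_AE borel_measurable_integrable square_integrable_prod sq)
qed

lift_definition L2_scaleC :: "complex \<Rightarrow> L2 \<Rightarrow> L2" (infixr "*\<^sub>C" 75) is "\<lambda>c f x. c * f x"
  by (auto intro: square_integrable_scale elim: eventually_mono)

instantiation L2 :: real_inner
begin

lift_definition zero_L2 :: L2 is "\<lambda>_. 0"
  by (simp add: square_integrable_zero)

lift_definition plus_L2 :: "L2 \<Rightarrow> L2 \<Rightarrow> L2" is "\<lambda>f g x. f x + g x"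
  by (auto intro: square_integrable_add elim: eventually_elim2)

definition uminus_L2 :: "L2 \<Rightarrow> L2" where "- f = (-1) *\<^sub>C f"
definition minus_L2 :: "L2 \<Rightarrow> L2 \<Rightarrow> L2" where "f - g = f + (- g)" for f g :: L2
definition scaleR_L2 :: "real \<Rightarrow> L2 \<Rightarrow> L2" where "r *\<^sub>R f = complex_of_real r *\<^sub>C f"
definition inner_L2 :: "L2 \<Rightarrow> L2 \<Rightarrow> real" where "f \<bullet> g = Re (L2_cinner f g)"
definition norm_L2 :: "L2 \<Rightarrow> real" where "norm f = sqrt (f \<bullet> f)" for f :: L2
definition sgn_L2 :: "L2 \<Rightarrow> L2" where "sgn f = inverse (norm f) *\<^sub>R f" for f :: L2
definition dist_L2 :: "L2 \<Rightarrow> L2 \<Rightarrow> real" where "dist f g = norm (f - g)" for f g :: L2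
definition uniformity_L2 :: "(L2 \<times> L2) filter" where
  "uniformity_L2 = (INF e\<in>{0<..}. principal {(f, g). dist f g < e})"
definition open_L2 :: "L2 set \<Rightarrow> bool" where
  "open_L2 U = (\<forall>f\<in>U. \<forall>\<^sub>F (f', g) in uniformity. f' = f \<longrightarrow> g \<in> U)"

lemma L2_cinner_commute: "L2_cinner f g = cnj (L2_cinner g f)"
  by transfer (simp add: Bochner_Integration.integral_cnj[symmetric] mult.commute del: Bochner_Integration.integral_cnj)

lemma L2_cinner_add_left: "L2_cinner (f + g) h = L2_cinner f h + L2_cinner g h"
  by transfer (simp add: distrib_right square_integrable_prod)

lemma L2_cinner_scaleC_left: "L2_cinner (c *\<^sub>C f) g = c * L2_cinner f g"
  by transfer (simp add: mult.assoc)

lemma L2_cinner_self: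
  "Re (L2_cinner f f) \<ge> 0 \<and> (Re (L2_cinner f f) = 0 \<longleftrightarrow> f = 0)"
proof (transfer, elim conjE)
  fix f assume f: "square_integrable f"
  have [measurable]: "f \<in> borel_measurable lebesgue"
    and i: "integrable lebesgue (\<lambda>x. (cmod (f x))\<^sup>2)"
    using f by (auto simp: square_integrable_def)
  have "(LINT x|lebesgue. f x * cnj (f x))
      = complex_of_real (LINT x|lebesgue. (cmod (f x))\<^sup>2)"
    by (simp only: complex_norm_square[symmetric] integral_complex_of_real)
  then show "0 \<le> Re (LINT x|lebesgue. f x * cnj (f x)) \<and>
      (Re (LINT x|lebesgue. f x * cnj (f x)) = 0 \<longleftrightarrow>
       square_integrable f \<and> square_integrable (\<lambda>_. 0) \<and> (AE x in lebesgue. f x = 0))"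
    using i f square_integrable_zero by (simp add: integral_nonneg_eq_0_iff_AE)
qed

instance
proof
  fix f g h :: L2 and a b r :: real
  show "f + g + h = f + (g + h)"
    by transfer (auto simp: add.assoc intro!: square_integrable_add)
  show "f + g = g + f"
    by transfer (auto simp: add.commute intro!: square_integrable_add)
  show "0 + f = f" by transfer auto
  show "- f + f = 0"
    unfolding uminus_L2_def
    by transfer (auto simp: square_integrable_zero)
  show "f - g = f + - g" by (simp add: minus_L2_def)
  show "a *\<^sub>R (f + g) = a *\<^sub>R f + a *\<^sub>R g"
    unfolding scaleR_L2_def
    by transfer (auto simp: distrib_left intro!: square_integrable_add square_integrable_scale)
  show "(a + b) *\<^sub>R f = a *\<^sub>R f + b *\<^sub>R f"
    unfolding scaleR_L2_def
    by transfer (auto simp: distrib_right intro!: square_integrable_add square_integrable_scale)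
  show "a *\<^sub>R b *\<^sub>R f = (a * b) *\<^sub>R f"
    unfolding scaleR_L2_def
    by transfer (auto simp: mult.assoc intro!: square_integrable_scale)
  show "1 *\<^sub>R f = f"
    unfolding scaleR_L2_def by transfer auto
  show "f \<bullet> g = g \<bullet> f"
    unfolding inner_L2_def by (subst L2_cinner_commute) simp
  show "(f + g) \<bullet> h = f \<bullet> h + g \<bullet> h"
    by (simp add: inner_L2_def L2_cinner_add_left)
  show "(r *\<^sub>R f) \<bullet> g = r * (f \<bullet> g)"
    by (simp add: inner_L2_def scaleR_L2_def L2_cinner_scaleC_left)
  show "0 \<le> f \<bullet> f" "f \<bullet> f = 0 \<longleftrightarrow> f = 0"
    using L2_cinner_self[of f] by (auto simp: inner_L2_def)
qed (simp_all add: norm_L2_def sgn_L2_def dist_L2_def uniformity_L2_def open_L2_def)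

end

lemma L2_cinner_norm: "L2_cinner f f = complex_of_real ((norm f)\<^sup>2)"
proof (rule complex_eqI)
  show "Re (L2_cinner f f) = Re (complex_of_real ((norm f)\<^sup>2))"
    by (simp add: power2_norm_eq_inner inner_L2_def)
  have "L2_cinner f f = cnj (L2_cinner f f)" by (rule L2_cinner_commute)
  then show "Im (L2_cinner f f) = Im (complex_of_real ((norm f)\<^sup>2))"
    by (metis Im_complex_of_real Reals_cnj_iff complex_is_Real_iff)
qed

text \<open>The multiplication operator by \<open>g\<close>; meaningful for essentially bounded measurable \<open>g\<close>,
  in which case the product below is square integrable.\<close>

definition mult_op :: "(real \<Rightarrow> complex) \<Rightarrow> L2 \<Rightarrow> L2" where
  "mult_op g f = abs_L2 (\<lambda>x. g x * rep_L2 f x)"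

lemma mult_op_abs_L2:
  assumes f: "square_integrable f" and g: "g \<in> borel_measurable lebesgue"
    and C: "AE x in lebesgue. cmod (g x) \<le> C"
  shows "mult_op g (abs_L2 f) = abs_L2 (\<lambda>x. g x * f x)"
proof -
  have r: "square_integrable (rep_L2 (abs_L2 f)) \<and> square_integrable f \<and>
      (AE x in lebesgue. rep_L2 (abs_L2 f) x = f x)"
    using rep_abs_rsp_left[OF Quotient3_L2, of f f] f by auto
  then have "AE x in lebesgue. g x * rep_L2 (abs_L2 f) x = g x * f x"
    by (auto elim: eventually_mono)
  then show ?thesis
    unfolding mult_op_def
    by (intro Quotient3_rel_abs[OF Quotient3_L2] conjI square_integrable_mult_bounded[OF _ g C])
      (use r f in auto)
qed

definition fourier_integral :: "(real \<Rightarrow> complex) \<Rightarrow> real \<Rightarrow> complex" where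
  "fourier_integral f \<xi> = (LINT x|lebesgue. f x * cis (- (x * \<xi>))) / sqrt (2 * pi)"

text \<open>A square integrable function need not be integrable, so its Fourier transform is defined
  as the limit in \<open>L2\<close> of the Fourier integrals of its truncations, which are both integrable and
  square integrable. By Plancherel's theorem the Fourier integrals of the truncations are square
  integrable and the limit exists.\<close>

definition fourier :: "L2 \<Rightarrow> L2" where
  "fourier f =
     lim (\<lambda>n. abs_L2 (fourier_integral (\<lambda>x. indicator {- real n..real n} x * rep_L2 f x)))"

text \<open>The vector below exists and is unique when \<open>T\<close> is bounded and complex linear.\<close>

definition L2_adjoint :: "(L2 \<Rightarrow> L2) \<Rightarrow> L2 \<Rightarrow> L2" where
  "L2_adjoint T g = (THE h. \<forall>f. L2_cinner (T f) g = L2_cinner f h)"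

definition time_proj :: "real set \<Rightarrow> L2 \<Rightarrow> L2" where
  "time_proj S = mult_op (indicator S)"

definition freq_proj :: "real set \<Rightarrow> L2 \<Rightarrow> L2" where
  "freq_proj \<Sigma> = L2_adjoint fourier \<circ> mult_op (indicator \<Sigma>) \<circ> fourier"

definition annihilating_pair :: "real set \<Rightarrow> real set \<Rightarrow> bool" where
  "annihilating_pair S \<Sigma> \<longleftrightarrow> (\<forall>f. time_proj S f = f \<and> freq_proj \<Sigma> f = f \<longrightarrow> f = 0)"

definition numerical_range :: "(L2 \<Rightarrow> L2) \<Rightarrow> complex set" where
  "numerical_range T = {L2_cinner (T f) f | f. norm f = 1}"

end

theory Submission
  imports Defs "HOL-Probability.Sinc_Integral"
begin

text \<open>A vector is fixed by an orthogonal projection exactly if the projection preserves its length, and the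
fixed vectors are the range. All four conditions therefore say that the two projections have no
common fixed vector apart from zero: \<open>1 + \<i>\<close> and \<open>1\<close> are extreme values of the quadratic forms of
\<open>P + \<i> Q\<close> and \<open>P Q\<close> on unit vectors, and by Cauchy--Schwarz they are attained only at vectors that
both projections leave unshortened (\<open>numerical_range_sum_iff\<close>, \<open>numerical_range_comp_iff\<close>).

What has to be shown is that the frequency projection is an orthogonal projection. That it is
self-adjoint and idempotent follows if the adjoint of the Fourier transform exists and is a right inverse of it,
so the substance is Plancherel's theorem in its unitary form.

For the indicator functions of two intervals, the inner product of the Fourier transforms is a combination of
integrals of \<open>(1 - cos (t * x)) / x\<^sup>2\<close>, which come from the Dirichlet integral; the result is the length of
the intersection (\<open>cinner_fourier_integral_ivl\<close>). By sesquilinearity the Fourier transform is isometric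
on step functions, which are dense (\<open>step_L2_dense\<close>). For functions restricted to a bounded
window, the Fourier integral at a fixed frequency is a continuous functional, so the isometry passes to
limits by Fatou's lemma (\<open>window_plancherel\<close>). Letting the window grow, completeness (\<open>L2_complete\<close>) gives
the limit that defines the Fourier transform, and the transform is an isometry (\<open>norm_fourier\<close>).

Fubini's theorem on intervals and density give the symmetry \<open>\<integral> fourier f * g = \<integral> f * fourier g\<close>
(\<open>fourier_multiplication_formula\<close>). It shows that the adjoint is \<open>fourier\<close> conjugated by
complex conjugation. Thus the adjoint is isometric too, and this makes \<open>fourier\<close> surjective
(\<open>fourier_fourier_adjoint\<close>).\<close>

section \<open>Square integrable functions as vectors\<close>

lemma square_integrable_rep_L2 [simp]: "square_integrable (rep_L2 f)"
  using Quotient3_rel_rep[OF Quotient3_L2, of f f] by simp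

lemma abs_rep_L2 [simp]: "abs_L2 (rep_L2 f) = f"
  by (rule Quotient3_abs_rep[OF Quotient3_L2])

lemma rep_abs_L2_AE:
  "square_integrable f \<Longrightarrow> AE x in lebesgue. rep_L2 (abs_L2 f) x = f x"
  using rep_abs_rsp_left[OF Quotient3_L2, of f f] by auto

lemma abs_L2_eqI:
  assumes "square_integrable f" "square_integrable g" "AE x in lebesgue. f x = g x"
  shows "abs_L2 f = abs_L2 g"
  by (intro Quotient3_rel_abs[OF Quotient3_L2]) (use assms in auto)

lemma cinner_abs_L2:
  "square_integrable f \<Longrightarrow> square_integrable g \<Longrightarrow>
    L2_cinner (abs_L2 f) (abs_L2 g) = (LINT x|lebesgue. f x * cnj (g x))"
  by (rule L2_cinner.abs_eq) auto

lemma plus_abs_L2: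
  "square_integrable f \<Longrightarrow> square_integrable g \<Longrightarrow>
    abs_L2 f + abs_L2 g = abs_L2 (\<lambda>x. f x + g x)"
  by (rule plus_L2.abs_eq) auto

lemma scaleC_abs_L2: "square_integrable f \<Longrightarrow> c *\<^sub>C abs_L2 f = abs_L2 (\<lambda>x. c * f x)"
  by (rule L2_scaleC.abs_eq) auto

lemma square_integrable_diff:
  assumes "square_integrable f" "square_integrable g"
  shows "square_integrable (\<lambda>x. f x - g x)"
  using square_integrable_add[OF assms(1) square_integrable_scale[OF assms(2), of "-1"]] by simp

lemma minus_abs_L2:
  assumes "square_integrable f" "square_integrable g"
  shows "abs_L2 f - abs_L2 g = abs_L2 (\<lambda>x. f x - g x)"
  using plus_abs_L2[OF assms(1) square_integrable_scale[OF assms(2), of "-1"]]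
  by (simp add: minus_L2_def uminus_L2_def scaleC_abs_L2 assms)

lemma square_integrable_iff_nn_integral:
  "square_integrable f \<longleftrightarrow>
    f \<in> borel_measurable lebesgue \<and> (\<integral>\<^sup>+x. ennreal ((cmod (f x))\<^sup>2) \<partial>lebesgue) < \<infinity>"
  unfolding square_integrable_def by (auto simp: integrable_iff_bounded)

lemma norm_abs_L2:
  assumes "square_integrable f"
  shows "(norm (abs_L2 f))\<^sup>2 = (LINT x|lebesgue. (cmod (f x))\<^sup>2)"
proof -
  have "complex_of_real ((norm (abs_L2 f))\<^sup>2) = (LINT x|lebesgue. f x * cnj (f x))"
    by (simp add: L2_cinner_norm[symmetric] cinner_abs_L2 assms del: of_real_power)
  also have "\<dots> = complex_of_real (LINT x|lebesgue. (cmod (f x))\<^sup>2)"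
    by (simp only: complex_norm_square[symmetric] integral_complex_of_real)
  finally show ?thesis by (simp only: of_real_eq_iff)
qed

lemma nn_integral_norm_L2:
  assumes "square_integrable f"
  shows "(\<integral>\<^sup>+x. ennreal ((cmod (f x))\<^sup>2) \<partial>lebesgue) = ennreal ((norm (abs_L2 f))\<^sup>2)"
  unfolding norm_abs_L2[OF assms]
  by (rule nn_integral_eq_integral) (use assms in \<open>auto simp: square_integrable_def\<close>)

lemma L2_cinner_add_right: "L2_cinner h (f + g) = L2_cinner h f + L2_cinner h g"
  by (subst (1 2 3) L2_cinner_commute) (simp add: L2_cinner_add_left)

lemma L2_cinner_scaleC_right: "L2_cinner f (c *\<^sub>C g) = cnj c * L2_cinner f g"
  by (subst (1 2) L2_cinner_commute) (simp add: L2_cinner_scaleC_left)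

lemma L2_cinner_minus_left: "L2_cinner (f - g) h = L2_cinner f h - L2_cinner g h"
  by (simp add: minus_L2_def uminus_L2_def L2_cinner_add_left L2_cinner_scaleC_left)

lemma L2_cinner_minus_right: "L2_cinner h (f - g) = L2_cinner h f - L2_cinner h g"
  by (simp add: minus_L2_def uminus_L2_def L2_cinner_add_right L2_cinner_scaleC_right)

lemma L2_scaleC_add: "c *\<^sub>C (f + g) = c *\<^sub>C f + c *\<^sub>C g"
  by transfer (auto simp: distrib_left intro!: square_integrable_add square_integrable_scale)

lemma L2_scaleC_scaleC: "c *\<^sub>C d *\<^sub>C f = (c * d) *\<^sub>C f"
  by transfer (auto simp: mult.assoc intro!: square_integrable_scale)

lemma L2_scaleC_diff: "c *\<^sub>C (f - g) = c *\<^sub>C f - c *\<^sub>C g"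
  by (simp add: minus_L2_def uminus_L2_def L2_scaleC_add L2_scaleC_scaleC mult.commute)

lemma L2_eqI:
  assumes "\<And>h. L2_cinner h f = L2_cinner h g"
  shows "f = g"
proof -
  have "L2_cinner (f - g) (f - g) = 0"
    by (simp add: L2_cinner_minus_right assms)
  then show ?thesis by (simp add: L2_cinner_norm)
qed

lemma norm_L2_scaleC: "norm (c *\<^sub>C f) = cmod c * norm f"
proof -
  have "complex_of_real ((norm (c *\<^sub>C f))\<^sup>2) = (c * cnj c) * complex_of_real ((norm f)\<^sup>2)"
    unfolding L2_cinner_norm[symmetric]
    by (simp add: L2_cinner_scaleC_left L2_cinner_scaleC_right)
  also have "\<dots> = complex_of_real ((cmod c * norm f)\<^sup>2)"
    by (simp only: complex_norm_square[symmetric] of_real_mult[symmetric] power_mult_distrib)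
  finally have "(norm (c *\<^sub>C f))\<^sup>2 = (cmod c * norm f)\<^sup>2"
    by (simp only: of_real_eq_iff)
  then show ?thesis by (rule power2_eq_imp_eq) auto
qed

lemma L2_cinner_eq_inner:
  "L2_cinner f g = Complex (f \<bullet> g) (f \<bullet> (\<i> *\<^sub>C g))"
  by (rule complex_eqI) (auto simp: inner_L2_def L2_cinner_scaleC_right)

lemma tendsto_scaleC_L2:
  assumes "(X \<longlongrightarrow> f) F" shows "((\<lambda>n. c *\<^sub>C X n) \<longlongrightarrow> c *\<^sub>C f) F"
proof -
  have "((\<lambda>n. cmod c * norm (X n - f)) \<longlongrightarrow> cmod c * 0) F"
    using assms by (intro tendsto_intros) (simp add: LIM_zero tendsto_norm_zero)
  then have "((\<lambda>n. c *\<^sub>C X n - c *\<^sub>C f) \<longlongrightarrow> 0) F"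
    by - (rule tendsto_norm_zero_cancel, simp add: L2_scaleC_diff[symmetric] norm_L2_scaleC)
  then show ?thesis by (rule LIM_zero_cancel)
qed

lemma tendsto_cinner_L2 [tendsto_intros]:
  assumes "(X \<longlongrightarrow> f) F" "(Y \<longlongrightarrow> g) F"
  shows "((\<lambda>n. L2_cinner (X n) (Y n)) \<longlongrightarrow> L2_cinner f g) F"
  unfolding L2_cinner_eq_inner by (intro tendsto_intros tendsto_scaleC_L2 assms)

section \<open>Completeness of the space of square integrable functions\<close>

text \<open>Fatou's lemma bounds the distance of a term to the pointwise limit by the distances to the later terms,
so a Cauchy sequence in norm cannot have a pointwise limit other than its limit in norm. This is how
values computed pointwise, such as Fourier integrals, are identified with limits in \<open>L2\<close>.\<close>

lemma L2_Fatou: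
  assumes sq: "\<And>n. square_integrable (f n)"
    and Cauchy: "Cauchy (\<lambda>n. abs_L2 (f n))"
    and u [measurable]: "u \<in> borel_measurable lebesgue"
    and lim: "AE x in lebesgue. (\<lambda>n. f n x) \<longlonglongrightarrow> u x"
  shows "square_integrable u" "(\<lambda>n. abs_L2 (f n)) \<longlonglongrightarrow> abs_L2 u"
proof -
  have [measurable]: "f n \<in> borel_measurable lebesgue" for n
    using sq[of n] by (simp add: square_integrable_def)
  have bound: "(\<integral>\<^sup>+x. ennreal ((cmod (f n x - u x))\<^sup>2) \<partial>lebesgue) \<le> ennreal (e\<^sup>2)"
    if e: "\<And>m. m \<ge> N \<Longrightarrow> norm (abs_L2 (f n) - abs_L2 (f m)) \<le> e" for n N e
  proof -
    have e0: "0 \<le> e" using e[of N] norm_ge_zero order_trans by blast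
    have "(\<integral>\<^sup>+x. ennreal ((cmod (f n x - u x))\<^sup>2) \<partial>lebesgue)
        = (\<integral>\<^sup>+x. liminf (\<lambda>m. ennreal ((cmod (f n x - f m x))\<^sup>2)) \<partial>lebesgue)"
    proof (rule nn_integral_cong_AE)
      show "AE x in lebesgue. ennreal ((cmod (f n x - u x))\<^sup>2)
          = liminf (\<lambda>m. ennreal ((cmod (f n x - f m x))\<^sup>2))"
        using lim
      proof eventually_elim
        case (elim x)
        have "(\<lambda>m. ennreal ((cmod (f n x - f m x))\<^sup>2)) \<longlonglongrightarrow> ennreal ((cmod (f n x - u x))\<^sup>2)"
          using elim by (intro tendsto_ennrealI tendsto_intros)
        then show ?case by (rule lim_imp_Liminf[symmetric, rotated]) simp
      qed
    qed
    also have "\<dots> \<le> liminf (\<lambda>m. \<integral>\<^sup>+x. ennreal ((cmod (f n x - f m x))\<^sup>2) \<partial>lebesgue)"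
      by (rule nn_integral_liminf) measurable
    also have "\<dots> \<le> liminf (\<lambda>m. ennreal (e\<^sup>2))"
    proof (rule Liminf_mono)
      show "\<forall>\<^sub>F m in sequentially.
          (\<integral>\<^sup>+x. ennreal ((cmod (f n x - f m x))\<^sup>2) \<partial>lebesgue) \<le> ennreal (e\<^sup>2)"
        using eventually_ge_at_top[of N]
      proof eventually_elim
        case (elim m)
        then show ?case
          using e[of m] by (simp add: nn_integral_norm_L2 square_integrable_diff sq
              minus_abs_L2 power_mono)
      qed
    qed
    finally show ?thesis by (simp add: Liminf_const)
  qed
  have ex: "\<exists>N. \<forall>n\<ge>N. \<forall>m\<ge>N. norm (abs_L2 (f n) - abs_L2 (f m)) < e" if "e > 0" for e
    using CauchyD[OF Cauchy that] by blast
  from ex[of 1] obtain N where N: "\<And>n m. n \<ge> N \<Longrightarrow> m \<ge> N \<Longrightarrow> norm (abs_L2 (f n) - abs_L2 (f m)) < 1"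
    by auto
  have "(\<integral>\<^sup>+x. ennreal ((cmod (f N x - u x))\<^sup>2) \<partial>lebesgue) \<le> ennreal (1\<^sup>2)"
    by (rule bound[of N]) (use N in \<open>auto intro: less_imp_le\<close>)
  then have "square_integrable (\<lambda>x. f N x - u x)"
    by (simp add: square_integrable_iff_nn_integral le_less_trans)
  from square_integrable_diff[OF sq[of N] this] show u_sq: "square_integrable u" by simp
  show "(\<lambda>n. abs_L2 (f n)) \<longlonglongrightarrow> abs_L2 u"
  proof (rule LIMSEQ_I)
    fix r :: real assume r: "0 < r"
    from ex[of "r/2"] r obtain N
      where N: "\<And>n m. n \<ge> N \<Longrightarrow> m \<ge> N \<Longrightarrow> norm (abs_L2 (f n) - abs_L2 (f m)) < r/2" by auto
    have "norm (abs_L2 (f n) - abs_L2 u) < r" if "n \<ge> N" for n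
    proof -
      have "(\<integral>\<^sup>+x. ennreal ((cmod (f n x - u x))\<^sup>2) \<partial>lebesgue) \<le> ennreal ((r/2)\<^sup>2)"
        by (rule bound[of N]) (use N that in \<open>auto intro: less_imp_le\<close>)
      then have "(norm (abs_L2 (f n) - abs_L2 u))\<^sup>2 \<le> (r/2)\<^sup>2"
        by (simp add: minus_abs_L2 sq u_sq nn_integral_norm_L2 square_integrable_diff)
      then have "norm (abs_L2 (f n) - abs_L2 u) \<le> r/2"
        by (rule power2_le_imp_le) (use r in simp)
      then show ?thesis using r by simp
    qed
    then show "\<exists>no. \<forall>n\<ge>no. norm (abs_L2 (f n) - abs_L2 u) < r" by blast
  qed
qed

text \<open>The Riesz--Fischer theorem. Along a subsequence with geometrically decreasing increments \<open>d k\<close>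
the sum of \<open>2^k * (d k)\<^sup>2\<close> has a finite integral, hence is finite almost everywhere. This makes
the increments absolutely summable, so the subsequence converges pointwise.\<close>

lemma L2_complete:
  fixes X :: "nat \<Rightarrow> L2"
  assumes "Cauchy X" shows "convergent X"
proof -
  have "\<exists>N. \<forall>n\<ge>N. \<forall>m\<ge>N. norm (X n - X m) < (1/4)^k" for k :: nat
    using CauchyD[OF assms, of "(1/4)^k"] by auto
  then obtain N0 where N0: "\<And>k n m. n \<ge> N0 k \<Longrightarrow> m \<ge> N0 k \<Longrightarrow> norm (X n - X m) < (1/4)^k"
    by metis
  define r where "r k = (\<Sum>j\<le>k. N0 j) + k" for k
  have rN: "r k \<ge> N0 k" for k
    unfolding r_def using member_le_sum[of k "{..k}" N0] by simp
  have smr: "strict_mono r" unfolding strict_mono_Suc_iff r_def by simp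
  have rle: "r k \<le> r (Suc k)" for k using smr by (simp add: strict_mono_less_eq)
  define f where "f k = rep_L2 (X (r k))" for k
  define d where "d k x = cmod (f (Suc k) x - f k x)" for k x
  have sq: "square_integrable (f k)" for k by (simp add: f_def)
  have [measurable]: "f n \<in> borel_measurable lebesgue" for n
    using sq[of n] by (simp add: square_integrable_def)
  have [measurable]: "d n \<in> borel_measurable lebesgue" for n
    unfolding d_def by measurable
  have dint: "(\<integral>\<^sup>+x. ennreal (2^k * (d k x)\<^sup>2) \<partial>lebesgue) \<le> ennreal ((1/2)^k)" for k
  proof -
    have "norm (X (r (Suc k)) - X (r k)) < (1/4)^k"
      by (intro N0) (use rN[of k] rle[of k] in linarith)+
    then have le: "(norm (X (r (Suc k)) - X (r k)))\<^sup>2 \<le> ((1/4)^k)\<^sup>2"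
      by (intro power_mono) auto
    have "(\<integral>\<^sup>+x. ennreal (2^k * (d k x)\<^sup>2) \<partial>lebesgue)
        = ennreal (2^k) * (\<integral>\<^sup>+x. ennreal ((d k x)\<^sup>2) \<partial>lebesgue)"
      by (subst nn_integral_cmult[symmetric]) (auto simp: ennreal_mult)
    also have "(\<integral>\<^sup>+x. ennreal ((d k x)\<^sup>2) \<partial>lebesgue) = ennreal ((norm (X (r (Suc k)) - X (r k)))\<^sup>2)"
      unfolding d_def
      by (subst nn_integral_norm_L2)
        (auto simp: minus_abs_L2[symmetric] sq square_integrable_diff f_def)
    also have "ennreal (2^k) * \<dots> \<le> ennreal (2^k) * ennreal (((1/4)^k)\<^sup>2)"
      using le by (intro mult_left_mono ennreal_leI) auto
    also have "\<dots> = ennreal (2^k * ((1/4)^k)\<^sup>2)"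
      by (simp add: ennreal_mult)
    also have "\<dots> \<le> ennreal ((1/2)^k)"
    proof (rule ennreal_leI)
      have "(2::real)^k * ((1/4)^k)\<^sup>2 = (1/8)^k"
        by (simp add: power_mult[symmetric] power_mult_distrib[symmetric] mult.commute[of k]
            power_mult power2_eq_square)
      also have "\<dots> \<le> (1/2)^k" by (rule power_mono) auto
      finally show "(2::real)^k * ((1/4)^k)\<^sup>2 \<le> (1/2)^k" .
    qed
    finally show ?thesis .
  qed
  have "(\<integral>\<^sup>+x. (\<Sum>k. ennreal (2^k * (d k x)\<^sup>2)) \<partial>lebesgue)
      = (\<Sum>k. \<integral>\<^sup>+x. ennreal (2^k * (d k x)\<^sup>2) \<partial>lebesgue)"
    by (rule nn_integral_suminf) measurable
  also have "\<dots> \<le> (\<Sum>k. ennreal ((1/2)^k))"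
    by (intro suminf_le dint) auto
  also have "\<dots> = ennreal (\<Sum>k. (1/2)^k)"
    by (intro suminf_ennreal2) (auto intro: summable_geometric)
  finally have fin: "(\<integral>\<^sup>+x. (\<Sum>k. ennreal (2^k * (d k x)\<^sup>2)) \<partial>lebesgue) \<noteq> \<infinity>"
    by (auto simp: top_unique)
  have "AE x in lebesgue. (\<Sum>k. ennreal (2^k * (d k x)\<^sup>2)) \<noteq> \<infinity>"
    by (rule nn_integral_PInf_AE[OF _ fin]) measurable
  then have conv: "AE x in lebesgue. convergent (\<lambda>k. f k x)"
  proof eventually_elim
    case (elim x)
    then have s1: "summable (\<lambda>k. 2^k * (d k x)\<^sup>2)"
      by (intro summable_suminf_not_top) (auto simp: d_def)
    have "summable (\<lambda>k. (1/2)^k + 2^k * (d k x)\<^sup>2 :: real)"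
      by (intro summable_add s1 summable_geometric) auto
    then have "summable (\<lambda>k. f (Suc k) x - f k x)"
    proof (rule summable_comparison_test')
      fix k :: nat
      \<comment> \<open>This is \<open>2 * a * b \<le> a\<^sup>2 + b\<^sup>2\<close> with \<open>a * b = d k x\<close>.\<close>
      have "0 \<le> (1/2)^k * (1 - 2^k * d k x)\<^sup>2 + d k x" by (simp add: d_def)
      also have "\<dots> = (1/2)^k + 2^k * (d k x)\<^sup>2 - d k x"
        by (simp add: power2_eq_square algebra_simps power_one_over)
      finally show "norm (f (Suc k) x - f k x) \<le> (1/2)^k + 2^k * (d k x)\<^sup>2"
        by (simp add: d_def)
    qed
    then have "convergent (\<lambda>n. \<Sum>k<n. f (Suc k) x - f k x)"
      by (simp add: summable_iff_convergent)
    then have "convergent (\<lambda>n. f n x - f 0 x)" by (simp add: sum_lessThan_telescope[of "\<lambda>k. f k x"])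
    then show ?case using convergent_diff_const_right_iff by blast
  qed
  define u where "u x = lim (\<lambda>k. f k x)" for x
  have [measurable]: "u \<in> borel_measurable lebesgue" unfolding u_def by measurable
  have "Cauchy (X \<circ> r)" by (rule Cauchy_subseq_Cauchy[OF assms smr])
  then have C: "Cauchy (\<lambda>n. abs_L2 (f n))" by (simp add: f_def o_def)
  have "AE x in lebesgue. (\<lambda>n. f n x) \<longlonglongrightarrow> u x"
    using conv unfolding u_def convergent_LIMSEQ_iff .
  then have "(\<lambda>n. abs_L2 (f n)) \<longlonglongrightarrow> abs_L2 u"
    by (rule L2_Fatou(2)[OF sq C, rotated]) measurable
  then have "(X \<circ> r) \<longlonglongrightarrow> abs_L2 u" by (simp add: f_def o_def)
  then have "X \<longlonglongrightarrow> abs_L2 u" by (rule Cauchy_converges_subseq[OF assms smr])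
  then show ?thesis by (rule convergentI)
qed

section \<open>Density of step functions\<close>

lemma square_integrable_measurable: "square_integrable f \<Longrightarrow> f \<in> borel_measurable lebesgue"
  by (simp add: square_integrable_def)

lemma L2_dominated:
  assumes fm: "\<And>n. f n \<in> borel_measurable lebesgue" and g: "square_integrable g"
    and u: "u \<in> borel_measurable lebesgue"
    and lim: "AE x in lebesgue. (\<lambda>n. f n x) \<longlonglongrightarrow> u x"
    and bound: "\<And>n x. cmod (f n x) \<le> cmod (g x)"
  shows "(\<lambda>n. abs_L2 (f n)) \<longlonglongrightarrow> abs_L2 u"
proof -
  have [measurable]: "f n \<in> borel_measurable lebesgue" "u \<in> borel_measurable lebesgue"
    "g \<in> borel_measurable lebesgue" for n
    using assms by (auto simp: square_integrable_def)
  have gi: "integrable lebesgue (\<lambda>x. (cmod (g x))\<^sup>2)"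
    using g by (simp add: square_integrable_def)
  have fsq: "square_integrable (f n)" for n
    unfolding square_integrable_def
    by (intro conjI Bochner_Integration.integrable_bound[OF gi]) (auto intro!: power_mono bound)
  have ub: "AE x in lebesgue. cmod (u x) \<le> cmod (g x)"
    using lim
  proof eventually_elim
    case (elim x)
    show ?case
      by (rule LIMSEQ_le_const2[OF tendsto_norm[OF elim]]) (use bound in auto)
  qed
  have usq: "square_integrable u"
    unfolding square_integrable_def
    by (intro conjI Bochner_Integration.integrable_bound[OF gi])
      (use ub in \<open>auto intro!: power_mono elim: eventually_mono\<close>)
  have lim2: "AE x in lebesgue. (\<lambda>n. (cmod (f n x - u x))\<^sup>2) \<longlonglongrightarrow> 0"
    using lim
  proof eventually_elim
    case (elim x)
    then have "(\<lambda>n. (cmod (f n x - u x))\<^sup>2) \<longlonglongrightarrow> (cmod (u x - u x))\<^sup>2"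
      by (intro tendsto_intros)
    then show ?case by simp
  qed
  have bound2: "AE x in lebesgue. norm ((cmod (f n x - u x))\<^sup>2) \<le> 4 * (cmod (g x))\<^sup>2" for n
    using ub
  proof eventually_elim
    case (elim x)
    have "cmod (f n x - u x) \<le> 2 * cmod (g x)"
      using norm_triangle_ineq4[of "f n x" "u x"] bound[of n x] elim by linarith
    then have "(cmod (f n x - u x))\<^sup>2 \<le> (2 * cmod (g x))\<^sup>2"
      by (rule power_mono) simp
    then show ?case by (simp add: power_mult_distrib)
  qed
  have "(\<lambda>n. LINT x|lebesgue. (cmod (f n x - u x))\<^sup>2) \<longlonglongrightarrow> (LINT x::real|lebesgue. (0::real))"
    by (rule integral_dominated_convergence[OF _ _ _ lim2 bound2]) (use gi in auto)
  then have "(\<lambda>n. (norm (abs_L2 (f n) - abs_L2 u))\<^sup>2) \<longlonglongrightarrow> 0"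
    by (simp add: minus_abs_L2 fsq usq norm_abs_L2 square_integrable_diff)
  then have "(\<lambda>n. sqrt ((norm (abs_L2 (f n) - abs_L2 u))\<^sup>2)) \<longlonglongrightarrow> sqrt 0"
    by (rule tendsto_real_sqrt)
  then have "(\<lambda>n. norm (abs_L2 (f n) - abs_L2 u)) \<longlonglongrightarrow> 0" by simp
  then show "(\<lambda>n. abs_L2 (f n)) \<longlonglongrightarrow> abs_L2 u"
    by (rule LIM_zero_cancel[OF tendsto_norm_zero_cancel])
qed

lemma sum_abs_L2:
  assumes "finite I" "\<And>i. i \<in> I \<Longrightarrow> square_integrable (f i)"
  shows "square_integrable (\<lambda>x. \<Sum>i\<in>I. f i x) \<and> (\<Sum>i\<in>I. abs_L2 (f i)) = abs_L2 (\<lambda>x. \<Sum>i\<in>I. f i x)"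
  using assms
proof (induction I rule: finite_induct)
  case empty
  then show ?case by (simp add: square_integrable_zero zero_L2.abs_eq)
next
  case (insert i I)
  then show ?case by (simp add: square_integrable_add plus_abs_L2)
qed

lemma square_integrable_indicator_mult:
  assumes "square_integrable f" "A \<in> sets lebesgue"
  shows "square_integrable (\<lambda>x. indicator A x * f x)"
  by (rule square_integrable_mult_bounded[OF assms(1), where C = 1])
    (use assms in \<open>auto simp: indicator_def intro: borel_measurable_indicator\<close>)

lemma square_integrable_bounded_support:
  assumes "f \<in> borel_measurable lebesgue" "\<And>x. cmod (f x) \<le> C * indicator {a..b} x"
  shows "square_integrable f"
proof -
  have i: "integrable lebesgue (\<lambda>x. C\<^sup>2 * indicator {a..b} x :: real)"
    by (intro integrable_mult_right integrable_real_indicator) (auto simp: emeasure_lborel_Icc_eq)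
  have "(cmod (f x))\<^sup>2 \<le> C\<^sup>2 * indicator {a..b} x" for x
    using power_mono[OF assms(2)[of x], of 2] by (cases "x \<in> {a..b}") auto
  then have "integrable lebesgue (\<lambda>x. (cmod (f x))\<^sup>2)"
    using assms(1) by (intro Bochner_Integration.integrable_bound[OF i]) auto
  with assms(1) show ?thesis by (simp add: square_integrable_def)
qed

lemma square_integrable_indicator:
  assumes "A \<in> sets lebesgue" "A \<subseteq> {a..b}"
  shows "square_integrable (indicator A)"
  by (rule square_integrable_bounded_support[where C = 1 and a = a and b = b])
    (use assms in \<open>auto simp: indicator_def intro: borel_measurable_indicator\<close>)

definition ivl_L2 :: "real \<Rightarrow> real \<Rightarrow> L2" where
  "ivl_L2 a b = abs_L2 (indicator {a..b})"

text \<open>The span is taken over the reals; the complex multiples among the generators make it a complex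
subspace.\<close>

definition step_L2 :: "L2 set" where
  "step_L2 = span {c *\<^sub>C ivl_L2 a b | c a b. a \<le> b}"

lemma square_integrable_indicator_ivl [simp]: "square_integrable (indicator {a..b::real})"
  by (rule square_integrable_indicator) auto

lemma ivl_in_step_L2: "a \<le> b \<Longrightarrow> c *\<^sub>C ivl_L2 a b \<in> step_L2"
  unfolding step_L2_def by (intro span_base) blast

lemma step_L2_induct [consumes 1, case_names ivl add]:
  assumes "f \<in> step_L2"
    and ivl: "\<And>c a b. a \<le> b \<Longrightarrow> P (c *\<^sub>C ivl_L2 a b)"
    and add: "\<And>c a b g. a \<le> b \<Longrightarrow> g \<in> step_L2 \<Longrightarrow> P g \<Longrightarrow> P (c *\<^sub>C ivl_L2 a b + g)"
  shows "P f"
proof -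
  have "f \<in> step_L2 \<and> P f"
    using assms(1) unfolding step_L2_def
  proof (induction f rule: span_induct_alt)
    case base
    have "P (0 *\<^sub>C ivl_L2 0 0)" by (rule ivl) simp
    moreover have "0 *\<^sub>C ivl_L2 0 0 = 0" using norm_L2_scaleC[of 0 "ivl_L2 0 0"] by simp
    ultimately show ?case by (simp add: span_zero)
  next
    case (step r x y)
    then obtain c a b where x: "x = c *\<^sub>C ivl_L2 a b" "a \<le> b" by auto
    have rx: "r *\<^sub>R x = (complex_of_real r * c) *\<^sub>C ivl_L2 a b"
      by (simp add: x scaleR_L2_def L2_scaleC_scaleC)
    have "P (r *\<^sub>R x + y)"
      unfolding rx using step x by (intro add) (auto simp: step_L2_def)
    then show ?case
      using span_add[OF span_scale[OF span_base[OF step(1)]]] step by blast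
  qed
  then show ?thesis ..
qed

lemma step_L2_add: "f \<in> step_L2 \<Longrightarrow> g \<in> step_L2 \<Longrightarrow> f + g \<in> step_L2"
  unfolding step_L2_def by (rule span_add)

lemma step_L2_scaleC: "f \<in> step_L2 \<Longrightarrow> c *\<^sub>C f \<in> step_L2"
  by (induction f rule: step_L2_induct)
    (simp_all add: L2_scaleC_scaleC L2_scaleC_add ivl_in_step_L2 step_L2_add)

lemma step_closure_limit:
  "X \<longlonglongrightarrow> f \<Longrightarrow> (\<And>n. X n \<in> closure step_L2) \<Longrightarrow> f \<in> closure step_L2"
  using closed_closure[of step_L2] unfolding closed_sequential_limits by blast

lemma step_closure_scaleC:
  assumes "f \<in> closure step_L2" shows "c *\<^sub>C f \<in> closure step_L2"
proof -
  from assms obtain X where X: "\<And>n. X n \<in> step_L2" "X \<longlonglongrightarrow> f"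
    unfolding closure_sequential by blast
  show ?thesis
    by (rule step_closure_limit[OF tendsto_scaleC_L2[OF X(2)]])
      (use X(1) step_L2_scaleC closure_subset in blast)
qed

lemma step_closure_add:
  assumes "f \<in> closure step_L2" "g \<in> closure step_L2" shows "f + g \<in> closure step_L2"
proof -
  from assms obtain X Y where X: "\<And>n. X n \<in> step_L2" "X \<longlonglongrightarrow> f"
    and Y: "\<And>n. Y n \<in> step_L2" "Y \<longlonglongrightarrow> g"
    unfolding closure_sequential by blast
  have "X n + Y n \<in> step_L2" for n
    by (intro step_L2_add X Y)
  then show ?thesis
    by (intro step_closure_limit[OF tendsto_add[OF X(2) Y(2)]]) (use closure_subset in blast)
qed

lemma step_closure_diff:
  "f \<in> closure step_L2 \<Longrightarrow> g \<in> closure step_L2 \<Longrightarrow> f - g \<in> closure step_L2"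
  unfolding minus_L2_def uminus_L2_def by (intro step_closure_add step_closure_scaleC)

lemma step_closure_zero: "0 \<in> closure step_L2"
  using closure_subset span_zero unfolding step_L2_def by blast

lemma step_closure_sum:
  "(\<And>i. i \<in> I \<Longrightarrow> f i \<in> closure step_L2) \<Longrightarrow> (\<Sum>i\<in>I. f i) \<in> closure step_L2"
  by (induction I rule: infinite_finite_induct) (auto intro: step_closure_zero step_closure_add)

lemma abs_L2_indicator_empty: "abs_L2 (indicator {}) = 0"
proof -
  have "(indicator {} :: real \<Rightarrow> complex) = (\<lambda>_. 0)" by auto
  then show ?thesis by (simp only: zero_L2.abs_eq)
qed

lemma ivl_L2_in_closure: "ivl_L2 a b \<in> closure step_L2"
proof (cases "a \<le> b")
  case True
  have "1 *\<^sub>C ivl_L2 a b \<in> step_L2"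
    unfolding step_L2_def using True by (intro span_base) blast
  moreover have "1 *\<^sub>C ivl_L2 a b = ivl_L2 a b"
    by (simp add: ivl_L2_def scaleC_abs_L2)
  ultimately show ?thesis using closure_subset by auto
next
  case False
  then have "ivl_L2 a b = 0" by (simp add: ivl_L2_def abs_L2_indicator_empty)
  then show ?thesis by (simp add: step_closure_zero)
qed

text \<open>Dynkin's \<open>\<pi>\<close>-\<open>\<lambda>\<close> argument: half-lines generate the Borel sets and are closed under intersection. Cutting
with a fixed interval keeps all indicators square integrable, so that complements and disjoint unions
stay inside the closure.\<close>

lemma borel_indicator_in_closure:
  assumes "A \<in> sets borel"
  shows "abs_L2 (indicator (A \<inter> {-r..r})) \<in> closure step_L2"
proof -
  let ?P = "\<lambda>A. abs_L2 (indicator (A \<inter> {-r..r})) \<in> closure step_L2"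
  have "Int_stable (range (\<lambda>a::real. {..a}))"
    by (auto simp: Int_stable_def)
  moreover have "range (\<lambda>a::real. {..a}) \<subseteq> Pow UNIV" by simp
  moreover have "A \<in> sigma_sets UNIV (range (\<lambda>a::real. {..a}))"
    using assms by (simp add: borel_eq_atMost)
  ultimately show "?P A"
  proof (induction A rule: sigma_sets_induct_disjoint)
    fix A :: "real set" assume "A \<in> range (\<lambda>a::real. {..a})"
    then obtain a where "A = {..a}" by auto
    then have "A \<inter> {-r..r} = {-r..min a r}" by auto
    then show "?P A" using ivl_L2_in_closure[of "-r" "min a r"] by (simp add: ivl_L2_def)
  next
    show "?P {}" using step_closure_zero by (simp add: abs_L2_indicator_empty)
  next
    fix A :: "real set" assume A: "A \<in> sigma_sets UNIV (range (\<lambda>a::real. {..a}))" and P: "?P A"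
    have [measurable]: "A \<in> sets lborel" using A by (simp add: borel_eq_atMost)
    have sq: "square_integrable (indicator (A \<inter> {-r..r}))"
      by (rule square_integrable_indicator[of _ "-r" r]) auto
    have "ivl_L2 (-r) r - abs_L2 (indicator (A \<inter> {-r..r})) \<in> closure step_L2"
      by (intro step_closure_diff P ivl_L2_in_closure)
    also have "ivl_L2 (-r) r - abs_L2 (indicator (A \<inter> {-r..r}))
        = abs_L2 (\<lambda>x. indicator {-r..r} x - indicator (A \<inter> {-r..r}) x)"
      by (simp add: ivl_L2_def minus_abs_L2 sq)
    also have "(\<lambda>x. indicator {-r..r} x - indicator (A \<inter> {-r..r}) x :: complex)
        = indicator ((UNIV - A) \<inter> {-r..r})"
      by (auto simp: indicator_def)
    finally show "?P (UNIV - A)" .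
  next
    fix A :: "nat \<Rightarrow> real set"
    assume disj: "disjoint_family A" and A: "range A \<subseteq> sigma_sets UNIV (range (\<lambda>a::real. {..a}))"
      and P: "\<And>i. ?P (A i)"
    have Am[measurable]: "A i \<in> sets lborel" for i using A by (auto simp: borel_eq_atMost)
    have sq: "square_integrable (indicator (A i \<inter> {-r..r}))" for i
      by (rule square_integrable_indicator[of _ "-r" r]) auto
    define f :: "nat \<Rightarrow> real \<Rightarrow> complex" where "f n = indicator ((\<Union>i<n. A i) \<inter> {-r..r})" for n
    have fn: "f n = (\<lambda>x. \<Sum>i<n. indicator (A i \<inter> {-r..r}) x)" for n
    proof -
      have "f n = indicator (\<Union>i\<in>{..<n}. A i \<inter> {-r..r})"
        unfolding f_def by (rule arg_cong[where f = indicator]) auto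
      moreover have "disjoint_family_on (\<lambda>i. A i \<inter> {-r..r}) {..<n}"
        using disj by (auto simp: disjoint_family_on_def)
      ultimately show ?thesis
        by (simp only: indicator_UN_disjoint[OF finite_lessThan] fun_eq_iff simp_thms)
    qed
    have "abs_L2 (f n) = (\<Sum>i<n. abs_L2 (indicator (A i \<inter> {-r..r})))" for n
      unfolding fn using sum_abs_L2[of "{..<n}" "\<lambda>i. indicator (A i \<inter> {-r..r})"] sq by simp
    then have fP: "abs_L2 (f n) \<in> closure step_L2" for n
      using P by (auto intro: step_closure_sum)
    have "(\<lambda>n. abs_L2 (f n)) \<longlonglongrightarrow> abs_L2 (indicator ((\<Union>i. A i) \<inter> {-r..r}))"
    proof (rule L2_dominated[where g = "indicator {-r..r}"])
      show "f n \<in> borel_measurable lebesgue" for n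
        unfolding f_def by (intro borel_measurable_indicator) auto
      show "indicator ((\<Union>i. A i) \<inter> {-r..r}) \<in> borel_measurable lebesgue"
        by (intro borel_measurable_indicator) auto
      show "cmod (f n x) \<le> cmod (indicator {-r..r} x)" for n x
        by (auto simp: f_def indicator_def)
      have "(\<lambda>n. f n x) \<longlonglongrightarrow> indicator ((\<Union>i. A i) \<inter> {-r..r}) x" for x
        using tendsto_mult[OF LIMSEQ_indicator_UN[of A x] tendsto_const[of "indicator {-r..r} x"]]
        by (simp add: f_def indicator_inter_arith)
      then show "AE x in lebesgue. (\<lambda>n. f n x) \<longlonglongrightarrow> indicator ((\<Union>i. A i) \<inter> {-r..r}) x" by simp
    qed simp
    then show "?P (\<Union>i. A i)" by (rule step_closure_limit) (rule fP)
  qed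
qed

lemma lebesgue_indicator_in_closure:
  assumes "A \<in> sets lebesgue"
  shows "abs_L2 (indicator (A \<inter> {-r..r})) \<in> closure step_L2"
proof -
  from assms obtain S N N' where A: "A = S \<union> N" "N \<subseteq> N'" "N' \<in> null_sets lborel" "S \<in> sets lborel"
    by (rule sets_completionE)
  have "AE x in lebesgue. x \<notin> N'"
    using AE_not_in[OF A(3)] by (rule AE_completion)
  then have "AE x in lebesgue. indicator (A \<inter> {-r..r}) x = (indicator (S \<inter> {-r..r}) x :: complex)"
    by eventually_elim (use A in \<open>auto simp: indicator_def\<close>)
  moreover have "square_integrable (indicator (A \<inter> {-r..r}))" "square_integrable (indicator (S \<inter> {-r..r}))"
    using assms A by (auto intro!: square_integrable_indicator[of _ "-r" r])
  ultimately have "abs_L2 (indicator (A \<inter> {-r..r})) = abs_L2 (indicator (S \<inter> {-r..r}))"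
    by (intro abs_L2_eqI)
  with A(4) show ?thesis by (simp add: borel_indicator_in_closure)
qed

text \<open>A square integrable function is the limit of simple functions dominated by twice its modulus. Cutting
the \<open>i\<close>-th one to \<open>{-i..i}\<close> makes it a combination of indicators of bounded sets without losing
the domination.\<close>

lemma step_L2_dense: "closure step_L2 = UNIV"
proof -
  have "f \<in> closure step_L2" for f
  proof -
    define F where "F = rep_L2 f"
    have F: "square_integrable F" by (simp add: F_def)
    have [measurable]: "F \<in> borel_measurable lebesgue" using F by (rule square_integrable_measurable)
    obtain s where s: "\<And>i. simple_function lebesgue (s i)" "\<And>x. (\<lambda>i. s i x) \<longlonglongrightarrow> F x"
        "\<And>i x. cmod (s i x) \<le> 2 * cmod (F x)"
      using borel_measurable_implies_sequence_metric[of F lebesgue 0] by auto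
    have sm[measurable]: "s i \<in> borel_measurable lebesgue" for i
      using s(1) by (rule borel_measurable_simple_function)
    define g where "g i x = indicator {- real i..real i} x * s i x" for i x
    have "abs_L2 (g i) \<in> closure step_L2" for i
    proof -
      define A where "A y = s i -` {y}" for y
      have Am: "A y \<in> sets lebesgue" for y
        using simple_functionD(2)[OF s(1), of i "{y}"] by (simp add: A_def)
      have fin: "finite (range (s i))" using simple_functionD(1)[OF s(1), of i] by simp
      have sq: "square_integrable (indicator (A y \<inter> {- real i..real i}))" for y
        using Am by (auto intro!: square_integrable_indicator[of _ "- real i" "real i"])
      have "g i = (\<lambda>x. \<Sum>y\<in>range (s i). y * indicator (A y \<inter> {- real i..real i}) x)"
      proof
        fix x
        have "(\<Sum>y\<in>range (s i). y * indicator (A y \<inter> {- real i..real i}) x)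
            = (\<Sum>y\<in>range (s i). if y = s i x then y * indicator {- real i..real i} x else 0)"
          by (intro sum.cong) (auto simp: A_def indicator_def)
        then show "g i x = (\<Sum>y\<in>range (s i). y * indicator (A y \<inter> {- real i..real i}) x)"
          using fin by (simp add: g_def mult.commute)
      qed
      then have "abs_L2 (g i) = (\<Sum>y\<in>range (s i). abs_L2 (\<lambda>x. y * indicator (A y \<inter> {- real i..real i}) x))"
        using sum_abs_L2[OF fin, of "\<lambda>y x. y * indicator (A y \<inter> {- real i..real i}) x"]
          square_integrable_scale[OF sq] by auto
      also have "\<dots> = (\<Sum>y\<in>range (s i). y *\<^sub>C abs_L2 (indicator (A y \<inter> {- real i..real i})))"
        by (simp add: scaleC_abs_L2 sq)
      also have "\<dots> \<in> closure step_L2"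
        by (intro step_closure_sum step_closure_scaleC lebesgue_indicator_in_closure Am)
      finally show ?thesis .
    qed
    moreover have "(\<lambda>i. abs_L2 (g i)) \<longlonglongrightarrow> abs_L2 F"
    proof (rule L2_dominated[where g = "\<lambda>x. 2 * F x"])
      show "g n \<in> borel_measurable lebesgue" for n
        unfolding g_def by (intro borel_measurable_times borel_measurable_indicator) auto
      show "square_integrable (\<lambda>x. 2 * F x)" by (rule square_integrable_scale[OF F])
      show "cmod (g n x) \<le> cmod (2 * F x)" for n x
        using s(3)[of n x] by (simp add: g_def norm_mult indicator_def)
      have "(\<lambda>n. g n x) \<longlonglongrightarrow> F x" for x
      proof (rule Lim_transform_eventually[OF s(2)])
        obtain N :: nat where "\<bar>x\<bar> \<le> real N" using real_arch_simple by blast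
        then have "\<forall>n\<ge>N. s n x = g n x" by (auto simp: g_def indicator_def)
        then show "\<forall>\<^sub>F n in sequentially. s n x = g n x"
          unfolding eventually_sequentially by blast
      qed
      then show "AE x in lebesgue. (\<lambda>n. g n x) \<longlonglongrightarrow> F x" by simp
    qed measurable
    ultimately have "abs_L2 F \<in> closure step_L2" by (metis step_closure_limit)
    then show ?thesis by (simp add: F_def)
  qed
  then show ?thesis by auto
qed

text \<open>Density in the form in which it is used: to prove an identity between continuous expressions that is
additive in \<open>f\<close>, it suffices to compute with scaled intervals. The scalar is part of the base case
since expressions may be antilinear in \<open>f\<close>.\<close>

lemma L2_step_induct [case_names ivl add limit]:
  assumes ivl: "\<And>c a b. a \<le> b \<Longrightarrow> P (c *\<^sub>C ivl_L2 a b)"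
    and add: "\<And>f g. P f \<Longrightarrow> P g \<Longrightarrow> P (f + g)"
    and limit: "\<And>X f. (\<And>n::nat. P (X n)) \<Longrightarrow> X \<longlonglongrightarrow> f \<Longrightarrow> P f"
  shows "P f"
proof -
  have "f \<in> closure step_L2" by (simp add: step_L2_dense)
  then obtain X where X: "\<And>k. X k \<in> step_L2" "X \<longlonglongrightarrow> f"
    unfolding closure_sequential by blast
  have "P g" if "g \<in> step_L2" for g
    using that by (induction g rule: step_L2_induct) (auto intro: ivl add)
  with X show ?thesis by (intro limit[of X f]) auto
qed

section \<open>Multiplication by an indicator\<close>

lemma time_proj_abs_L2:
  "square_integrable f \<Longrightarrow> S \<in> sets lebesgue \<Longrightarrow>
    time_proj S (abs_L2 f) = abs_L2 (\<lambda>x. indicator S x * f x)"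
  unfolding time_proj_def
  by (rule mult_op_abs_L2[where C = 1])
    (auto simp: indicator_def intro: borel_measurable_indicator)

lemma time_proj_rep:
  "time_proj S f = abs_L2 (\<lambda>x. indicator S x * rep_L2 f x)"
  by (simp add: time_proj_def mult_op_def)

lemma time_proj_add:
  assumes "S \<in> sets lebesgue"
  shows "time_proj S (f + g) = time_proj S f + time_proj S g"
proof -
  have "time_proj S (abs_L2 (rep_L2 f) + abs_L2 (rep_L2 g))
      = time_proj S (abs_L2 (rep_L2 f)) + time_proj S (abs_L2 (rep_L2 g))"
    by (simp only: plus_abs_L2 time_proj_abs_L2 assms square_integrable_rep_L2
        square_integrable_add square_integrable_indicator_mult distrib_left)
  then show ?thesis by simp
qed

lemma time_proj_Int:
  assumes "S \<in> sets lebesgue" "T \<in> sets lebesgue"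
  shows "time_proj S (time_proj T f) = time_proj (S \<inter> T) f"
  using assms
  by (simp add: time_proj_rep[of T] time_proj_rep[of "S \<inter> T"] time_proj_abs_L2
      square_integrable_indicator_mult indicator_inter_arith mult.assoc)

lemma time_proj_selfadjoint:
  assumes "S \<in> sets lebesgue"
  shows "L2_cinner (time_proj S f) g = L2_cinner f (time_proj S g)"
proof -
  have "L2_cinner (time_proj S (abs_L2 (rep_L2 f))) (abs_L2 (rep_L2 g))
      = L2_cinner (abs_L2 (rep_L2 f)) (time_proj S (abs_L2 (rep_L2 g)))"
    by (simp only: time_proj_abs_L2 cinner_abs_L2 assms square_integrable_rep_L2
        square_integrable_indicator_mult complex_cnj_mult)
      (simp add: indicator_def mult_ac of_bool_def if_distrib[of cnj] cong: if_cong)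
  then show ?thesis by simp
qed

lemma time_proj_idem:
  assumes "S \<in> sets lebesgue" shows "time_proj S (time_proj S f) = time_proj S f"
  using time_proj_Int[OF assms assms] by simp

lemma time_proj_scaleC:
  assumes "S \<in> sets lebesgue"
  shows "time_proj S (c *\<^sub>C f) = c *\<^sub>C time_proj S f"
  by (rule L2_eqI)
    (simp add: time_proj_selfadjoint[OF assms, symmetric] L2_cinner_scaleC_right)

lemma time_proj_diff:
  assumes "S \<in> sets lebesgue"
  shows "time_proj S (f - g) = time_proj S f - time_proj S g"
  by (rule L2_eqI)
    (simp add: time_proj_selfadjoint[OF assms, symmetric] L2_cinner_minus_right)

lemma norm_projection_le:
  assumes "\<And>f g. L2_cinner (P f) g = L2_cinner f (P g)" "\<And>f. P (P f) = P f"
  shows "norm (P f) \<le> norm f"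
proof (cases "norm (P f) = 0")
  case False
  have "(norm (P f))\<^sup>2 = P f \<bullet> P f" by (simp add: power2_norm_eq_inner)
  also have "\<dots> = f \<bullet> P f" by (simp add: inner_L2_def assms)
  also have "\<dots> \<le> norm f * norm (P f)" by (rule norm_cauchy_schwarz)
  finally show ?thesis using False by (simp add: power2_eq_square)
qed simp

lemma norm_time_proj_le: "S \<in> sets lebesgue \<Longrightarrow> norm (time_proj S f) \<le> norm f"
  by (rule norm_projection_le) (auto simp: time_proj_selfadjoint time_proj_idem)

lemma time_proj_tendsto: "(\<lambda>n. time_proj {- real n..real n} f) \<longlonglongrightarrow> f"
proof -
  define F where "F = rep_L2 f"
  have F: "square_integrable F" by (simp add: F_def)
  have "(\<lambda>n. abs_L2 (\<lambda>x. indicator {- real n..real n} x * F x)) \<longlonglongrightarrow> abs_L2 F"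
  proof (rule L2_dominated[OF _ F])
    show "(\<lambda>x. indicator {- real n..real n} x * F x) \<in> borel_measurable lebesgue" for n
      using square_integrable_measurable[OF F]
      by (intro borel_measurable_times borel_measurable_indicator) auto
    show "F \<in> borel_measurable lebesgue" using F by (rule square_integrable_measurable)
    show "cmod (indicator {- real n..real n} x * F x) \<le> cmod (F x)" for n x
      by (simp add: indicator_def)
    have "(\<lambda>n. indicator {- real n..real n} x * F x) \<longlonglongrightarrow> F x" for x
    proof (rule tendsto_eventually)
      obtain N :: nat where "\<bar>x\<bar> \<le> real N" using real_arch_simple by blast
      then have "\<forall>n\<ge>N. indicator {- real n..real n} x * F x = F x" by (auto simp: indicator_def)
      then show "\<forall>\<^sub>F n in sequentially. indicator {- real n..real n} x * F x = F x"
        unfolding eventually_sequentially by blast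
    qed
    then show "AE x in lebesgue. (\<lambda>n. indicator {- real n..real n} x * F x) \<longlonglongrightarrow> F x" by simp
  qed
  then show ?thesis by (simp add: F_def time_proj_rep)
qed

section \<open>The Plancherel identity for intervals\<close>

text \<open>Integration by parts turns this integral into the Dirichlet integral: \<open>(cos x - 1) / x + Si x\<close>
is an antiderivative on the positive half-line, and it increases from \<open>0\<close> to \<open>pi / 2\<close>. Parity and
scaling give the rest.\<close>

lemma has_bochner_integral_one_minus_cos_over_square:
  "has_bochner_integral lborel (\<lambda>x. (1 - cos (t * x)) / x\<^sup>2) (pi * \<bar>t\<bar>)"
proof -
  let ?f = "\<lambda>x::real. (1 - cos x) / x\<^sup>2"
  let ?F = "\<lambda>x::real. (cos x - 1) / x + Si x"
  have lim0: "((\<lambda>x::real. (cos x - 1) / x) \<longlongrightarrow> 0) (at_right 0)"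
  proof -
    have "((\<lambda>x::real. (cos x - cos 0) / (x - 0)) \<longlongrightarrow> - sin 0) (at 0)"
      using DERIV_cos[of "0::real"] by (simp only: has_field_derivative_iff)
    then show ?thesis by (simp add: filterlim_at_split)
  qed
  have A: "((?F \<circ> real_of_ereal) \<longlongrightarrow> 0) (at_right (ereal 0))"
  proof -
    have "(Si \<longlongrightarrow> Si 0) (at_right 0)"
      using isCont_Si[of 0] by (simp add: isCont_def filterlim_at_split)
    moreover have "Si 0 = 0" using Si_neg[of 0] by simp
    ultimately have "(Si \<longlongrightarrow> 0) (at_right 0)" by simp
    from tendsto_add[OF lim0 this] have "(?F \<longlongrightarrow> 0) (at_right 0)" by simp
    then show ?thesis unfolding ereal_tendsto_simps1 .
  qed
  have B: "((?F \<circ> real_of_ereal) \<longlongrightarrow> pi / 2) (at_left \<infinity>)"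
  proof -
    have "((\<lambda>x::real. (cos x - 1) / x) \<longlongrightarrow> 0) at_top"
    proof (rule Lim_null_comparison[where g = "\<lambda>x. 2 * inverse x"])
      show "\<forall>\<^sub>F x::real in at_top. norm ((cos x - 1) / x) \<le> 2 * inverse x"
        using eventually_gt_at_top[of 0]
      proof eventually_elim
        case (elim x)
        have "\<bar>cos x - 1\<bar> \<le> 2" using cos_ge_minus_one[of x] cos_le_one[of x] by linarith
        then show ?case using elim by (simp add: divide_simps)
      qed
      show "((\<lambda>x::real. 2 * inverse x) \<longlongrightarrow> 0) at_top"
        by (intro tendsto_mult_right_zero tendsto_inverse_0_at_top filterlim_ident)
    qed
    from tendsto_add[OF this Si_at_top] show ?thesis by (simp add: ereal_tendsto_simps1)
  qed
  have der: "DERIV ?F x :> ?f x" if "0 < x" for x :: real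
  proof -
    have "DERIV ?F x :> ((- sin x) * x - (cos x - 1) * 1) / (x * x) + sinc x"
      using that by (intro DERIV_add DERIV_divide DERIV_Si) (auto intro!: derivative_eq_intros)
    also have "((- sin x) * x - (cos x - 1) * 1) / (x * x) + sinc x = ?f x"
      using that by (simp add: field_simps power2_eq_square)
    finally show ?thesis .
  qed
  have cont: "isCont ?f x" if "0 < x" for x :: real
    using that by (intro continuous_intros) auto
  have si: "set_integrable lborel (einterval (ereal 0) \<infinity>) ?f"
    "(LBINT x=ereal 0..\<infinity>. ?f x) = pi / 2 - 0"
    by (rule interval_integral_FTC_nonneg[OF _ _ _ _ A B]; use der cont in simp)+
  have half: "has_bochner_integral lborel (\<lambda>x. indicator {0<..} x * ?f x) (pi / 2)"
    using si by (simp add: has_bochner_integral_iff set_integrable_def interval_lebesgue_integral_def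
        set_lebesgue_integral_def einterval_eq(2))
  then have half': "has_bochner_integral lborel (\<lambda>x. indicator {0<..} (0 + (-1) * x) * ?f (0 + (-1) * x)) (pi / 2)"
    using lborel_has_bochner_integral_real_affine_iff[of "-1" "\<lambda>x. indicator {0<..} x * ?f x" "pi / 2" 0]
    by simp
  have full: "has_bochner_integral lborel ?f pi"
  proof -
    have "has_bochner_integral lborel (\<lambda>x. indicator {0<..} x * ?f x +
        indicator {0<..} (0 + (-1) * x) * ?f (0 + (-1) * x)) (pi / 2 + pi / 2)"
      by (rule has_bochner_integral_add[OF half half'])
    also have "(\<lambda>x. indicator {0<..} x * ?f x + indicator {0<..} (0 + (-1) * x) * ?f (0 + (-1) * x)) = ?f"
      by (rule ext) (auto simp: indicator_def)
    finally show ?thesis by simp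
  qed
  show ?thesis
  proof (cases "t = 0")
    case True
    then show ?thesis by (simp add: has_bochner_integral_zero)
  next
    case False
    have "has_bochner_integral lborel (\<lambda>x. ?f (0 + t * x)) (pi /\<^sub>R \<bar>t\<bar>)"
      using lborel_has_bochner_integral_real_affine_iff[OF False, of ?f pi 0] full by simp
    then have "has_bochner_integral lborel (\<lambda>x. t\<^sup>2 * ?f (0 + t * x)) (t\<^sup>2 * (pi /\<^sub>R \<bar>t\<bar>))"
      by (intro has_bochner_integral_mult_right)
    moreover have "(\<lambda>x. t\<^sup>2 * ?f (0 + t * x)) = (\<lambda>x. (1 - cos (t * x)) / x\<^sup>2)"
      using False by (auto simp: power_mult_distrib)
    moreover have "t\<^sup>2 * (pi /\<^sub>R \<bar>t\<bar>) = pi * \<bar>t\<bar>"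
      using False by (simp add: power2_eq_square field_simps abs_if)
    ultimately show ?thesis by (simp only:)
  qed
qed

lemma fourier_integral_ivl:
  assumes "a \<le> b"
  shows "fourier_integral (indicator {a..b}) \<xi> =
    (if \<xi> = 0 then complex_of_real (b - a)
     else (cis (- (a * \<xi>)) - cis (- (b * \<xi>))) / (\<i> * complex_of_real \<xi>)) / complex_of_real (sqrt (2 * pi))"
proof -
  have "(LINT x|lebesgue. indicator {a..b} x * cis (- (x * \<xi>)))
      = (LINT x|lborel. indicator {a..b} x *\<^sub>R cis (- (x * \<xi>)))"
  proof -
    have [measurable]: "(\<lambda>x. cis (- (x * \<xi>))) \<in> borel_measurable borel"
      by (intro borel_measurable_continuous_onI continuous_on_cis continuous_on_minus
          continuous_on_mult continuous_on_id continuous_on_const)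
    have "(\<lambda>x. indicator {a..b} x * cis (- (x * \<xi>))) \<in> borel_measurable lborel" by measurable
    then show ?thesis
      by (subst integral_completion) (auto simp: indicator_def intro!: Bochner_Integration.integral_cong)
  qed
  also have "\<dots> = (if \<xi> = 0 then complex_of_real (b - a)
     else (cis (- (a * \<xi>)) - cis (- (b * \<xi>))) / (\<i> * complex_of_real \<xi>))"
  proof (cases "\<xi> = 0")
    case True
    then show ?thesis using assms by (simp add: scaleR_conv_of_real cis_zero)
  next
    case False
    let ?G = "\<lambda>x. \<i> / complex_of_real \<xi> * cis (- (x * \<xi>))"
    have "(LINT x|lborel. indicator {a..b} x *\<^sub>R cis (- (x * \<xi>))) = ?G b - ?G a"
    proof (rule integral_FTC_Icc[OF assms])
      show "(?G has_vector_derivative cis (- (x * \<xi>))) (at x within {a..b})" for x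
      proof -
        have "((\<lambda>z. \<i> / complex_of_real \<xi> * exp (- (\<i> * z * complex_of_real \<xi>))) has_field_derivative
            exp (- (\<i> * complex_of_real x * complex_of_real \<xi>))) (at (complex_of_real x))"
          using False by (auto intro!: derivative_eq_intros)
        from has_vector_derivative_real_field[OF this] show ?thesis
          by (simp add: cis_conv_exp mult.assoc)
      qed
      show "continuous_on {a..b} (\<lambda>x. cis (- (x * \<xi>)))" by (intro continuous_intros)
    qed
    also have "\<dots> = (cis (- (a * \<xi>)) - cis (- (b * \<xi>))) / (\<i> * complex_of_real \<xi>)"
      using False by (simp add: field_simps)
    finally show ?thesis using False by simp
  qed
  finally show ?thesis by (simp add: fourier_integral_def)
qed

lemma fourier_integral_ivl_measurable:
  assumes "a \<le> b" shows "fourier_integral (indicator {a..b}) \<in> borel_measurable borel"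
proof -
  have [measurable]: "(\<lambda>\<xi>. cis (- (t * \<xi>))) \<in> borel_measurable borel" for t
    by (intro borel_measurable_continuous_onI continuous_on_cis continuous_on_minus
          continuous_on_mult continuous_on_id continuous_on_const)
  show ?thesis
    unfolding fourier_integral_ivl[OF assms, abs_def] by measurable
qed

text \<open>The product of the two transforms is a combination of four exponentials over \<open>\<xi>\<^sup>2\<close> whose coefficients
add up to zero. Replacing each \<open>cos\<close> by \<open>cos - 1\<close> therefore changes nothing, and every term becomes integrable.\<close>

lemma Re_fourier_integral_ivl_mult:
  assumes "a \<le> b" "c \<le> d" "\<xi> \<noteq> 0"
  shows "Re (fourier_integral (indicator {a..b}) \<xi> * cnj (fourier_integral (indicator {c..d}) \<xi>)) =
    ((1 - cos ((d - a) * \<xi>)) / \<xi>\<^sup>2 + (1 - cos ((c - b) * \<xi>)) / \<xi>\<^sup>2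
      - (1 - cos ((c - a) * \<xi>)) / \<xi>\<^sup>2 - (1 - cos ((d - b) * \<xi>)) / \<xi>\<^sup>2) / (2 * pi)"
proof -
  have "fourier_integral (indicator {a..b}) \<xi> * cnj (fourier_integral (indicator {c..d}) \<xi>)
     = (cis (- (a * \<xi>)) - cis (- (b * \<xi>))) * (cis (c * \<xi>) - cis (d * \<xi>)) / complex_of_real (\<xi>\<^sup>2 * (2 * pi))"
  proof -
    have "\<i> * complex_of_real \<xi> * complex_of_real (sqrt (2 * pi)) * (\<i> * complex_of_real \<xi> * complex_of_real (sqrt (2 * pi)))
        = \<i> * \<i> * complex_of_real (\<xi> * \<xi> * (sqrt (2 * pi) * sqrt (2 * pi)))"
      unfolding of_real_mult by (simp only: ac_simps)
    also have "\<dots> = - complex_of_real (\<xi> * \<xi> * (2 * pi))"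
      by simp
    finally have den: "\<i> * complex_of_real \<xi> * complex_of_real (sqrt (2 * pi)) * (\<i> * complex_of_real \<xi> * complex_of_real (sqrt (2 * pi)))
        = - complex_of_real (\<xi> * \<xi> * (2 * pi))" .
    show ?thesis
      using assms by (simp add: fourier_integral_ivl cis_cnj power2_eq_square den del: of_real_mult)
  qed
  also have "(cis (- (a * \<xi>)) - cis (- (b * \<xi>))) * (cis (c * \<xi>) - cis (d * \<xi>))
     = cis ((c - a) * \<xi>) - cis ((d - a) * \<xi>) - cis ((c - b) * \<xi>) + cis ((d - b) * \<xi>)"
    by (simp add: algebra_simps cis_mult)
  finally have eq: "fourier_integral (indicator {a..b}) \<xi> * cnj (fourier_integral (indicator {c..d}) \<xi>) =
    (cis ((c - a) * \<xi>) - cis ((d - a) * \<xi>) - cis ((c - b) * \<xi>) + cis ((d - b) * \<xi>)) /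
      complex_of_real (\<xi>\<^sup>2 * (2 * pi))" .
  show ?thesis
    unfolding eq Re_divide_of_real using assms(3)
    by (simp add: divide_simps)
qed

lemma square_integrable_fourier_integral_ivl:
  assumes "a \<le> b" shows "square_integrable (fourier_integral (indicator {a..b}))"
proof -
  let ?E = "fourier_integral (indicator {a..b})"
  have [measurable]: "?E \<in> borel_measurable borel" by (rule fourier_integral_ivl_measurable[OF assms])
  have i: "integrable lborel (\<lambda>x. ((1 - cos ((b - a) * x)) / x\<^sup>2 + (1 - cos ((a - b) * x)) / x\<^sup>2) / (2 * pi))"
    using has_bochner_integral_one_minus_cos_over_square by (auto simp: has_bochner_integral_iff)
  have "integrable lborel (\<lambda>x. (cmod (?E x))\<^sup>2)"
  proof (rule integrable_cong_AE_imp[OF i])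
    show "AE x in lborel. ((1 - cos ((b - a) * x)) / x\<^sup>2 + (1 - cos ((a - b) * x)) / x\<^sup>2) / (2 * pi) = (cmod (?E x))\<^sup>2"
      using AE_lborel_singleton[of 0]
    proof eventually_elim
      case (elim x)
      have "(cmod (?E x))\<^sup>2 = Re (?E x * cnj (?E x))"
        by (simp only: complex_norm_square[symmetric] Re_complex_of_real)
      then show ?case using Re_fourier_integral_ivl_mult[OF assms assms elim] by simp
    qed
  qed measurable
  then show ?thesis
    by (simp add: square_integrable_def integrable_completion measurable_completion)
qed

text \<open>The length of the intersection of two intervals, written with absolute values so that it can be
compared term by term with the integrals of \<open>(1 - cos (t * x)) / x\<^sup>2\<close>.\<close>

lemma cinner_ivl:
  assumes "a \<le> b" "c \<le> d"
  shows "L2_cinner (ivl_L2 a b) (ivl_L2 c d) =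
    complex_of_real ((\<bar>d - a\<bar> + \<bar>c - b\<bar> - \<bar>c - a\<bar> - \<bar>d - b\<bar>) / 2)"
proof -
  have "L2_cinner (ivl_L2 a b) (ivl_L2 c d) = (LINT x|lebesgue. complex_of_real (indicator {max a c..min b d} x))"
  proof -
    have "indicator {a..b} x * cnj (indicator {c..d} x) = complex_of_real (indicator {max a c..min b d} x)" for x
      by (auto simp: indicator_def)
    then show ?thesis
      unfolding ivl_L2_def by (simp only: cinner_abs_L2 square_integrable_indicator_ivl)
  qed
  also have "\<dots> = complex_of_real (measure lborel {max a c..min b d})"
    by (simp only: integral_complex_of_real) simp
  also have "measure lborel {max a c..min b d} = (\<bar>d - a\<bar> + \<bar>c - b\<bar> - \<bar>c - a\<bar> - \<bar>d - b\<bar>) / 2"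
  proof (cases "max a c \<le> min b d")
    case True
    then show ?thesis using assms by (simp only: measure_lborel_Icc) (auto simp: max_def min_def abs_if field_simps)
  next
    case False
    then have "measure lborel {max a c..min b d} = 0" by simp
    moreover from False assms consider "b < c" | "d < a" by (auto simp: max_def min_def split: if_splits)
    then have "(\<bar>d - a\<bar> + \<bar>c - b\<bar> - \<bar>c - a\<bar> - \<bar>d - b\<bar>) / 2 = 0"
      by cases (use assms in auto)
    ultimately show ?thesis by simp
  qed
  finally show ?thesis .
qed

text \<open>The real parts agree by evaluating four integrals. The imaginary part vanishes because the transform
of a real function takes conjugate values at \<open>\<xi>\<close> and \<open>- \<xi>\<close>.\<close>

lemma cinner_fourier_integral_ivl:
  assumes "a \<le> b" "c \<le> d"
  shows "L2_cinner (abs_L2 (fourier_integral (indicator {a..b}))) (abs_L2 (fourier_integral (indicator {c..d}))) =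
    L2_cinner (ivl_L2 a b) (ivl_L2 c d)"
proof -
  let ?E = "fourier_integral (indicator {a..b})" and ?E' = "fourier_integral (indicator {c..d})"
  let ?g = "\<lambda>x. ?E x * cnj (?E' x)"
  let ?k = "\<lambda>t x::real. (1 - cos (t * x)) / x\<^sup>2"
  have [measurable]: "?E \<in> borel_measurable borel" "?E' \<in> borel_measurable borel"
    by (rule fourier_integral_ivl_measurable[OF assms(1)] fourier_integral_ivl_measurable[OF assms(2)])+
  have [measurable]: "(\<lambda>x. cnj (?E' x)) \<in> borel_measurable borel"
    by (rule measurable_compose[where g = cnj and N = borel])
      (simp_all add: borel_measurable_continuous_onI continuous_on_cnj)
  have gm: "?g \<in> borel_measurable borel" by measurable
  have gi: "integrable lborel ?g"
    using square_integrable_prod[OF square_integrable_fourier_integral_ivl[OF assms(1)]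
        square_integrable_fourier_integral_ivl[OF assms(2)]] by (simp add: integrable_completion)
  define I where "I = (LINT x|lborel. ?g x)"
  have I: "L2_cinner (abs_L2 ?E) (abs_L2 ?E') = I"
    unfolding I_def
    by (simp add: cinner_abs_L2 square_integrable_fourier_integral_ivl assms integral_completion)
  have sym: "fourier_integral (indicator {l..u}) (- x) = cnj (fourier_integral (indicator {l..u}) x)"
    if "l \<le> u" for l u x :: real
    using that by (simp add: fourier_integral_ivl cis_cnj)
  have "I = (LINT x|lborel. ?g (0 + (-1) * x))"
    unfolding I_def by (subst lborel_integral_real_affine[of "-1" _ 0]) auto
  also have "\<dots> = (LINT x|lborel. cnj (?g x))" using assms by (simp add: sym)
  also have "\<dots> = cnj I" unfolding I_def by (rule Bochner_Integration.integral_cnj)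
  finally have "Im I = 0" by (metis Reals_cnj_iff complex_is_Real_iff)
  moreover have "Re I = (\<bar>d - a\<bar> + \<bar>c - b\<bar> - \<bar>c - a\<bar> - \<bar>d - b\<bar>) / 2"
  proof -
    have "Re I = (LINT x|lborel. Re (?g x))" unfolding I_def
      by (rule integral_bounded_linear[OF bounded_linear_Re gi, symmetric])
    also have "\<dots> = (LINT x|lborel. (?k (d - a) x + ?k (c - b) x - ?k (c - a) x - ?k (d - b) x) / (2 * pi))"
    proof (rule integral_cong_AE)
      show "AE x in lborel. Re (?g x) = (?k (d - a) x + ?k (c - b) x - ?k (c - a) x - ?k (d - b) x) / (2 * pi)"
        using AE_lborel_singleton[of 0]
        by eventually_elim (rule Re_fourier_integral_ivl_mult[OF assms])
    qed measurable
    also have "\<dots> = (pi * \<bar>d - a\<bar> + pi * \<bar>c - b\<bar> - pi * \<bar>c - a\<bar> - pi * \<bar>d - b\<bar>) / (2 * pi)"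
      by (intro has_bochner_integral_integral_eq has_bochner_integral_divide has_bochner_integral_add
          has_bochner_integral_diff has_bochner_integral_one_minus_cos_over_square)
    also have "\<dots> = (\<bar>d - a\<bar> + \<bar>c - b\<bar> - \<bar>c - a\<bar> - \<bar>d - b\<bar>) / 2"
      by (simp add: field_simps)
    finally show ?thesis .
  qed
  ultimately have "I = complex_of_real ((\<bar>d - a\<bar> + \<bar>c - b\<bar> - \<bar>c - a\<bar> - \<bar>d - b\<bar>) / 2)"
    by (intro complex_eqI) auto
  then show ?thesis by (simp add: I cinner_ivl assms)
qed

section \<open>The Fourier transform is an isometry\<close>

definition window :: "nat \<Rightarrow> L2 \<Rightarrow> L2" where
  "window n = time_proj {- real n..real n}"

text \<open>Up to normalization, the Fourier integral over a window is the inner product with a wave cut to that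
window. Hence at every frequency it is continuous for the norm of \<open>L2\<close>.\<close>

definition wave :: "nat \<Rightarrow> real \<Rightarrow> L2" where
  "wave n \<xi> = abs_L2 (\<lambda>x. indicator {- real n..real n} x * cis (x * \<xi>))"

definition window_fourier :: "nat \<Rightarrow> L2 \<Rightarrow> real \<Rightarrow> complex" where
  "window_fourier n f = fourier_integral (\<lambda>x. indicator {- real n..real n} x * rep_L2 f x)"

lemma square_integrable_wave:
  "square_integrable (\<lambda>x. indicator {- real n..real n} x * cis (x * \<xi>))"
proof (rule square_integrable_bounded_support[where C = 1 and a = "- real n" and b = "real n"])
  have [measurable]: "(\<lambda>x. cis (x * \<xi>)) \<in> borel_measurable borel"
    by (intro borel_measurable_continuous_onI continuous_on_cis
          continuous_on_mult continuous_on_id continuous_on_const)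
  have "(\<lambda>x. indicator {- real n..real n} x * cis (x * \<xi>)) \<in> borel_measurable lborel" by measurable
  then show "(\<lambda>x. indicator {- real n..real n} x * cis (x * \<xi>)) \<in> borel_measurable lebesgue"
    by (rule measurable_completion)
qed (simp add: norm_mult indicator_def)

lemma window_fourier_eq_cinner:
  "window_fourier n f \<xi> = L2_cinner f (wave n \<xi>) / complex_of_real (sqrt (2 * pi))"
proof -
  have "L2_cinner (abs_L2 (rep_L2 f)) (wave n \<xi>) =
      (LINT x|lebesgue. rep_L2 f x * cnj (indicator {- real n..real n} x * cis (x * \<xi>)))"
    unfolding wave_def by (simp only: cinner_abs_L2 square_integrable_wave square_integrable_rep_L2)
  also have "\<dots> = (LINT x|lebesgue. indicator {- real n..real n} x * rep_L2 f x * cis (- (x * \<xi>)))"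
    by (intro Bochner_Integration.integral_cong) (auto simp: indicator_def cis_cnj)
  finally show ?thesis by (simp add: window_fourier_def fourier_integral_def)
qed

lemma window_set [simp]: "{- real n..real n} \<in> sets lebesgue" by simp

lemma window_selfadjoint: "L2_cinner (window n f) g = L2_cinner f (window n g)"
  by (simp add: window_def time_proj_selfadjoint)

lemma window_wave: "m \<le> n \<Longrightarrow> window m (wave n \<xi>) = wave m \<xi>"
proof -
  assume "m \<le> n"
  then have "(indicator {- real m..real m} x * (indicator {- real n..real n} x * cis (x * \<xi>)) :: complex)
      = indicator {- real m..real m} x * cis (x * \<xi>)" for x
    by (auto simp: indicator_def)
  then show ?thesis
    by (simp only: window_def wave_def time_proj_abs_L2 square_integrable_wave window_set)
qed

lemma window_fourier_window: "m \<le> n \<Longrightarrow> window_fourier n (window m f) = window_fourier m f"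
  by (simp add: fun_eq_iff window_fourier_eq_cinner window_selfadjoint window_wave)

lemma window_fourier_add: "window_fourier n (f + g) = (\<lambda>\<xi>. window_fourier n f \<xi> + window_fourier n g \<xi>)"
  by (simp add: fun_eq_iff window_fourier_eq_cinner L2_cinner_add_left add_divide_distrib)

lemma window_fourier_scaleC: "window_fourier n (c *\<^sub>C f) = (\<lambda>\<xi>. c * window_fourier n f \<xi>)"
  by (simp add: fun_eq_iff window_fourier_eq_cinner L2_cinner_scaleC_left)

lemma window_fourier_tendsto:
  assumes "X \<longlonglongrightarrow> f" shows "(\<lambda>k. window_fourier n (X k) \<xi>) \<longlonglongrightarrow> window_fourier n f \<xi>"
  unfolding window_fourier_eq_cinner by (intro tendsto_intros assms) simp

lemma window_ivl: "window n (ivl_L2 a b) = ivl_L2 (max a (- real n)) (min b (real n))"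
proof -
  have "(\<lambda>x. indicator {- real n..real n} x * indicator {a..b} x :: complex)
      = indicator {max a (- real n)..min b (real n)}"
    by (auto simp: indicator_def fun_eq_iff)
  then show ?thesis by (simp add: window_def ivl_L2_def time_proj_abs_L2)
qed

lemma fourier_integral_cong_AE:
  assumes "f \<in> borel_measurable lebesgue" "g \<in> borel_measurable lebesgue" "AE x in lebesgue. f x = g x"
  shows "fourier_integral f = fourier_integral g"
proof
  fix \<xi>
  have "(\<lambda>x. cis (- (x * \<xi>))) \<in> borel_measurable lborel"
    by (intro borel_measurable_continuous_onI[THEN borel_measurable_subalgebra[of borel lborel, rotated 2]]
       continuous_on_cis continuous_on_minus
          continuous_on_mult continuous_on_id continuous_on_const) auto
  then have [measurable]: "(\<lambda>x. cis (- (x * \<xi>))) \<in> borel_measurable lebesgue"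
    by (rule measurable_completion)
  have [measurable]: "f \<in> borel_measurable lebesgue" "g \<in> borel_measurable lebesgue" by fact+
  have "(LINT x|lebesgue. f x * cis (- (x * \<xi>))) = (LINT x|lebesgue. g x * cis (- (x * \<xi>)))"
    by (rule integral_cong_AE) (use assms(3) in \<open>auto elim: eventually_mono\<close>)
  then show "fourier_integral f \<xi> = fourier_integral g \<xi>" by (simp add: fourier_integral_def)
qed

lemma window_fourier_ivl:
  "window_fourier n (ivl_L2 a b) =
    fourier_integral (indicator {max a (- real n)..min b (real n)})"
proof -
  have "AE x in lebesgue. indicator {- real n..real n} x * rep_L2 (ivl_L2 a b) x =
      (indicator {max a (- real n)..min b (real n)} x :: complex)"
    using rep_abs_L2_AE[OF square_integrable_indicator_ivl, of a b]
    by eventually_elim (auto simp: ivl_L2_def indicator_def)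
  then show ?thesis
    unfolding window_fourier_def
    by (intro fourier_integral_cong_AE)
      (auto intro!: square_integrable_measurable square_integrable_indicator_mult)
qed

text \<open>An empty intersection is represented by the null interval \<open>{0..0}\<close>, so that the closed formulas, which
need ordered endpoints, cover this case too.\<close>

lemma window_ivl_cases:
  obtains a' b' where "a' \<le> b'" "window n (ivl_L2 a b) = ivl_L2 a' b'"
    "window_fourier n (ivl_L2 a b) = fourier_integral (indicator {a'..b'})"
proof (cases "max a (- real n) \<le> min b (real n)")
  case True
  then show ?thesis using that window_ivl window_fourier_ivl by blast
next
  case False
  let ?J = "{max a (- real n)..min b (real n)}"
  have ae: "AE x in lebesgue. indicator ?J x = (indicator {0..0::real} x :: complex)"
    using AE_completion[OF AE_lborel_singleton[of "0::real"]]
    by eventually_elim (use False in \<open>auto simp: indicator_def\<close>)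
  have "window n (ivl_L2 a b) = ivl_L2 0 0"
    unfolding window_ivl unfolding ivl_L2_def by (intro abs_L2_eqI ae square_integrable_indicator_ivl)
  moreover have "window_fourier n (ivl_L2 a b) = fourier_integral (indicator {0..0})"
    unfolding window_fourier_ivl
    by (intro fourier_integral_cong_AE ae square_integrable_measurable square_integrable_indicator_ivl)
  ultimately show ?thesis using that[of 0 0] by simp
qed

lemma square_integrable_window_fourier_ivl: "square_integrable (window_fourier n (c *\<^sub>C ivl_L2 a b))"
  by (rule window_ivl_cases[of n a b])
    (simp add: window_fourier_scaleC square_integrable_scale square_integrable_fourier_integral_ivl)

lemma square_integrable_window_fourier_step:
  "f \<in> step_L2 \<Longrightarrow> square_integrable (window_fourier n f)"
  by (induction f rule: step_L2_induct)
    (simp_all add: square_integrable_window_fourier_ivl window_fourier_add square_integrable_add)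

lemma window_scaleC: "window n (c *\<^sub>C f) = c *\<^sub>C window n f"
  by (simp add: window_def time_proj_scaleC)

lemma window_add: "window n (f + g) = window n f + window n g"
  by (simp add: window_def time_proj_add)

lemma window_plancherel_ivl:
  "L2_cinner (abs_L2 (window_fourier n (c *\<^sub>C ivl_L2 a b))) (abs_L2 (window_fourier n (d *\<^sub>C ivl_L2 a2 b2))) =
    L2_cinner (window n (c *\<^sub>C ivl_L2 a b)) (window n (d *\<^sub>C ivl_L2 a2 b2))"
proof -
  obtain a' b' where 1: "a' \<le> b'" "window n (ivl_L2 a b) = ivl_L2 a' b'"
    "window_fourier n (ivl_L2 a b) = fourier_integral (indicator {a'..b'})"
    by (rule window_ivl_cases)
  obtain a2' b2' where 2: "a2' \<le> b2'" "window n (ivl_L2 a2 b2) = ivl_L2 a2' b2'"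
    "window_fourier n (ivl_L2 a2 b2) = fourier_integral (indicator {a2'..b2'})"
    by (rule window_ivl_cases)
  show ?thesis
    using 1 2
    by (simp add: window_fourier_scaleC window_scaleC scaleC_abs_L2[symmetric]
        square_integrable_fourier_integral_ivl L2_cinner_scaleC_left L2_cinner_scaleC_right
        cinner_fourier_integral_ivl)
qed

lemma window_plancherel_step:
  assumes "f \<in> step_L2" "g \<in> step_L2"
  shows "L2_cinner (abs_L2 (window_fourier n f)) (abs_L2 (window_fourier n g)) = L2_cinner (window n f) (window n g)"
proof -
  have abs_add: "abs_L2 (window_fourier n (x + y)) = abs_L2 (window_fourier n x) + abs_L2 (window_fourier n y)"
    if "x \<in> step_L2" "y \<in> step_L2" for x y
    using that by (simp add: window_fourier_add plus_abs_L2 square_integrable_window_fourier_step)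
  have 1: "L2_cinner (abs_L2 (window_fourier n (c *\<^sub>C ivl_L2 a b))) (abs_L2 (window_fourier n g)) =
      L2_cinner (window n (c *\<^sub>C ivl_L2 a b)) (window n g)" if "a \<le> b" for c a b
    using assms(2)
    by (induction g rule: step_L2_induct)
      (simp_all add: abs_add ivl_in_step_L2 window_plancherel_ivl window_add L2_cinner_add_right)
  show ?thesis
    using assms(1)
    by (induction f rule: step_L2_induct)
      (simp_all add: abs_add ivl_in_step_L2 1 window_add L2_cinner_add_left)
qed

lemma window_diff: "window n (f - g) = window n f - window n g"
  by (simp add: window_def time_proj_diff)

lemma norm_window_le: "norm (window n f) \<le> norm f"
  by (simp add: window_def norm_time_proj_le)

lemma window_tendsto:
  assumes "X \<longlonglongrightarrow> f" shows "(\<lambda>k. window n (X k)) \<longlonglongrightarrow> window n f"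
proof (rule LIM_zero_cancel, rule tendsto_norm_zero_cancel, rule Lim_null_comparison)
  show "(\<lambda>k. norm (X k - f)) \<longlonglongrightarrow> 0" using assms by (simp add: LIM_zero tendsto_norm_zero)
  show "\<forall>\<^sub>F k in sequentially. norm (norm (window n (X k) - window n f)) \<le> norm (X k - f)"
    by (simp add: window_diff[symmetric] norm_window_le)
qed

text \<open>The isometry passes from step functions to their limits: the transforms form a Cauchy sequence by the
isometry itself, and they converge pointwise.\<close>

lemma window_plancherel:
  shows "square_integrable (window_fourier n f)"
    and "norm (abs_L2 (window_fourier n f)) = norm (window n f)"
proof -
  have "f \<in> closure step_L2" by (simp add: step_L2_dense)
  then obtain X where X: "\<And>k. X k \<in> step_L2" "X \<longlonglongrightarrow> f"
    unfolding closure_sequential by blast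
  have sq: "square_integrable (window_fourier n (X k))" for k
    by (rule square_integrable_window_fourier_step[OF X(1)])
  have nrm: "norm (abs_L2 (window_fourier n g)) = norm (window n g)" if "g \<in> step_L2" for g
  proof -
    have "complex_of_real ((norm (abs_L2 (window_fourier n g)))\<^sup>2) = complex_of_real ((norm (window n g))\<^sup>2)"
      unfolding L2_cinner_norm[symmetric] by (rule window_plancherel_step[OF that that])
    then show ?thesis by (simp only: of_real_eq_iff) (simp add: power2_eq_iff_nonneg)
  qed
  have diff: "norm (abs_L2 (window_fourier n (X k)) - abs_L2 (window_fourier n (X l))) \<le> norm (X k - X l)" for k l
  proof -
    have "X k - X l \<in> step_L2" using X(1) unfolding step_L2_def by (intro span_diff)
    moreover have "abs_L2 (window_fourier n (X k)) - abs_L2 (window_fourier n (X l)) = abs_L2 (window_fourier n (X k - X l))"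
    proof -
      have "window_fourier n (X k - X l) = (\<lambda>\<xi>. window_fourier n (X k) \<xi> - window_fourier n (X l) \<xi>)"
        by (simp add: fun_eq_iff window_fourier_eq_cinner L2_cinner_minus_left diff_divide_distrib)
      then show ?thesis by (simp add: minus_abs_L2 sq)
    qed
    ultimately show ?thesis using nrm norm_window_le by simp
  qed
  have "Cauchy (\<lambda>k. abs_L2 (window_fourier n (X k)))"
  proof (rule CauchyI)
    fix e :: real assume "0 < e"
    with CauchyD[OF LIMSEQ_imp_Cauchy[OF X(2)]] obtain M
      where "\<forall>m\<ge>M. \<forall>n\<ge>M. norm (X m - X n) < e" by blast
    then show "\<exists>M. \<forall>k\<ge>M. \<forall>l\<ge>M. norm (abs_L2 (window_fourier n (X k)) - abs_L2 (window_fourier n (X l))) < e"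
      using diff le_less_trans by blast
  qed
  moreover have "window_fourier n f \<in> borel_measurable lebesgue"
    by (rule borel_measurable_LIMSEQ_metric[where f = "\<lambda>k. window_fourier n (X k)"])
      (use sq square_integrable_measurable window_fourier_tendsto[OF X(2)] in auto)
  moreover have "AE \<xi> in lebesgue. (\<lambda>k. window_fourier n (X k) \<xi>) \<longlonglongrightarrow> window_fourier n f \<xi>"
    using window_fourier_tendsto[OF X(2)] by simp
  ultimately have F: "square_integrable (window_fourier n f)"
    "(\<lambda>k. abs_L2 (window_fourier n (X k))) \<longlonglongrightarrow> abs_L2 (window_fourier n f)"
    using L2_Fatou[where f = "\<lambda>k. window_fourier n (X k)", OF sq] by blast+
  show "square_integrable (window_fourier n f)" by (rule F(1))
  have "(\<lambda>k. norm (window n (X k))) \<longlonglongrightarrow> norm (abs_L2 (window_fourier n f))"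
    using tendsto_norm[OF F(2)] by (simp add: nrm X(1))
  then show "norm (abs_L2 (window_fourier n f)) = norm (window n f)"
    using tendsto_norm[OF window_tendsto[OF X(2)]] by (rule LIMSEQ_unique)
qed

text \<open>Enlarging the window from \<open>m\<close> to \<open>n\<close> changes the transform by the transform of the part of \<open>f\<close>
inside \<open>n\<close> and outside \<open>m\<close>, which is no longer than the tail of \<open>f\<close> outside \<open>m\<close>. So the
sequence that defines the Fourier transform is Cauchy.\<close>

lemma fourier_tendsto: "(\<lambda>n. abs_L2 (window_fourier n f)) \<longlonglongrightarrow> fourier f"
proof -
  have w: "(\<lambda>n. window n f) \<longlonglongrightarrow> f"
    unfolding window_def by (rule time_proj_tendsto)
  have step: "norm (abs_L2 (window_fourier n f) - abs_L2 (window_fourier m f)) \<le> norm (window m f - f)"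
    if "m \<le> n" for m n
  proof -
    have "window_fourier n (f - window m f) = (\<lambda>\<xi>. window_fourier n f \<xi> - window_fourier m f \<xi>)"
      using window_fourier_window[OF that, of f]
      by (simp add: fun_eq_iff window_fourier_eq_cinner L2_cinner_minus_left diff_divide_distrib)
    then have "abs_L2 (window_fourier n f) - abs_L2 (window_fourier m f) = abs_L2 (window_fourier n (f - window m f))"
      by (simp add: minus_abs_L2 window_plancherel(1))
    then show ?thesis
      using norm_window_le[of n "f - window m f"] by (simp add: window_plancherel(2) norm_minus_commute)
  qed
  have "Cauchy (\<lambda>n. abs_L2 (window_fourier n f))"
  proof (rule CauchyI)
    fix e :: real assume "0 < e"
    then obtain M where M: "norm (window M f - f) < e / 2"
      using LIMSEQ_D[OF w, of "e/2"] by auto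
    have "norm (abs_L2 (window_fourier k f) - abs_L2 (window_fourier l f)) < e" if "M \<le> k" "M \<le> l" for k l
    proof -
      have "norm (abs_L2 (window_fourier k f) - abs_L2 (window_fourier M f)) < e / 2"
        "norm (abs_L2 (window_fourier l f) - abs_L2 (window_fourier M f)) < e / 2"
        using step that M le_less_trans by blast+
      then show ?thesis by (rule norm_triangle_half_l)
    qed
    then show "\<exists>M. \<forall>k\<ge>M. \<forall>l\<ge>M. norm (abs_L2 (window_fourier k f) - abs_L2 (window_fourier l f)) < e"
      by blast
  qed
  then have "convergent (\<lambda>n. abs_L2 (window_fourier n f))" by (rule L2_complete)
  then show ?thesis
    unfolding convergent_LIMSEQ_iff fourier_def window_fourier_def .
qed

lemma fourier_add: "fourier (f + g) = fourier f + fourier g"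
proof (rule LIMSEQ_unique[OF fourier_tendsto])
  have "abs_L2 (window_fourier n (f + g)) = abs_L2 (window_fourier n f) + abs_L2 (window_fourier n g)" for n
    by (simp add: window_fourier_add plus_abs_L2 window_plancherel(1))
  then show "(\<lambda>n. abs_L2 (window_fourier n (f + g))) \<longlonglongrightarrow> fourier f + fourier g"
    by (simp add: tendsto_add fourier_tendsto)
qed

lemma fourier_scaleC: "fourier (c *\<^sub>C f) = c *\<^sub>C fourier f"
proof (rule LIMSEQ_unique[OF fourier_tendsto])
  have "abs_L2 (window_fourier n (c *\<^sub>C f)) = c *\<^sub>C abs_L2 (window_fourier n f)" for n
    by (simp add: window_fourier_scaleC scaleC_abs_L2 window_plancherel(1))
  then show "(\<lambda>n. abs_L2 (window_fourier n (c *\<^sub>C f))) \<longlonglongrightarrow> c *\<^sub>C fourier f"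
    by (simp add: tendsto_scaleC_L2 fourier_tendsto)
qed

lemma fourier_diff: "fourier (f - g) = fourier f - fourier g"
  by (simp add: minus_L2_def uminus_L2_def fourier_add fourier_scaleC)

theorem norm_fourier: "norm (fourier f) = norm f"
proof (rule LIMSEQ_unique)
  show "(\<lambda>n. norm (abs_L2 (window_fourier n f))) \<longlonglongrightarrow> norm (fourier f)"
    by (intro tendsto_norm fourier_tendsto)
  show "(\<lambda>n. norm (abs_L2 (window_fourier n f))) \<longlonglongrightarrow> norm f"
    unfolding window_plancherel(2) window_def by (intro tendsto_norm time_proj_tendsto)
qed

text \<open>Polarization, for the real inner product first; the complex one is recovered by inserting \<open>\<i>\<close>.\<close>

lemma cinner_fourier: "L2_cinner (fourier f) (fourier g) = L2_cinner f g"
proof -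
  have "fourier f \<bullet> fourier g = f \<bullet> g" for f g
    by (simp add: dot_norm fourier_add[symmetric] norm_fourier)
  then show ?thesis by (simp add: L2_cinner_eq_inner fourier_scaleC[symmetric])
qed

lemma tendsto_fourier:
  assumes "X \<longlonglongrightarrow> f" shows "(\<lambda>k. fourier (X k)) \<longlonglongrightarrow> fourier f"
proof (rule LIM_zero_cancel, rule tendsto_norm_zero_cancel)
  show "(\<lambda>k. norm (fourier (X k) - fourier f)) \<longlonglongrightarrow> 0"
    using assms by (simp add: fourier_diff[symmetric] norm_fourier LIM_zero tendsto_norm_zero)
qed

section \<open>The adjoint of the Fourier transform\<close>

lemma square_integrable_cnj: "square_integrable f \<Longrightarrow> square_integrable (\<lambda>x. cnj (f x))"
  unfolding square_integrable_def
  by (auto intro!: measurable_compose[where g = cnj and N = borel] borel_measurable_continuous_onI continuous_on_cnj continuous_on_id)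

lift_definition L2_conj :: "L2 \<Rightarrow> L2" is "\<lambda>f x. cnj (f x)"
  by (auto intro: square_integrable_cnj)

lemma L2_conj_conj [simp]: "L2_conj (L2_conj f) = f"
  by transfer auto

lemma L2_conj_add: "L2_conj (f + g) = L2_conj f + L2_conj g"
  by transfer (auto intro!: square_integrable_cnj square_integrable_add)

lemma L2_conj_scaleC: "L2_conj (c *\<^sub>C f) = cnj c *\<^sub>C L2_conj f"
  by transfer (auto intro!: square_integrable_cnj square_integrable_scale)

lemma L2_conj_diff: "L2_conj (f - g) = L2_conj f - L2_conj g"
  by (simp add: minus_L2_def uminus_L2_def L2_conj_add L2_conj_scaleC)

lemma cinner_conj_right: "L2_cinner f (L2_conj g) = L2_cinner g (L2_conj f)"
  by transfer (simp add: mult.commute)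

lemma cinner_conj_conj: "L2_cinner (L2_conj f) (L2_conj g) = L2_cinner g f"
  using cinner_conj_right[of "L2_conj f" g] by simp

lemma norm_L2_conj: "norm (L2_conj f) = norm f"
proof -
  have "complex_of_real ((norm (L2_conj f))\<^sup>2) = complex_of_real ((norm f)\<^sup>2)"
    unfolding L2_cinner_norm[symmetric] by (rule cinner_conj_conj)
  then show ?thesis by (simp only: of_real_eq_iff) simp
qed

lemma tendsto_L2_conj:
  assumes "X \<longlonglongrightarrow> f" shows "(\<lambda>k. L2_conj (X k)) \<longlonglongrightarrow> L2_conj f"
proof (rule LIM_zero_cancel, rule tendsto_norm_zero_cancel)
  show "(\<lambda>k. norm (L2_conj (X k) - L2_conj f)) \<longlonglongrightarrow> 0"
    using assms by (simp add: L2_conj_diff[symmetric] norm_L2_conj LIM_zero tendsto_norm_zero)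
qed

lemma L2_conj_ivl: "L2_conj (ivl_L2 a b) = ivl_L2 a b"
proof -
  have "L2_conj (ivl_L2 a b) = abs_L2 (\<lambda>x. cnj (indicator {a..b} x))"
    unfolding ivl_L2_def by (rule L2_conj.abs_eq) simp
  also have "(\<lambda>x. cnj (indicator {a..b} x)) = indicator {a..b}"
    by (auto simp: indicator_def fun_eq_iff)
  finally show ?thesis by (simp add: ivl_L2_def)
qed

lemma fourier_ivl:
  "fourier (ivl_L2 a b) = abs_L2 (fourier_integral (indicator {a..b}))"
proof (rule LIMSEQ_unique[OF fourier_tendsto tendsto_eventually])
  obtain N :: nat where N: "max \<bar>a\<bar> \<bar>b\<bar> \<le> real N" using real_arch_simple by blast
  have "max a (- real n) = a \<and> min b (real n) = b" if "N \<le> n" for n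
  proof -
    have "- real n \<le> a" "b \<le> real n" using that N by linarith+
    then show ?thesis by simp
  qed
  then have "\<forall>n\<ge>N. abs_L2 (window_fourier n (ivl_L2 a b)) = abs_L2 (fourier_integral (indicator {a..b}))"
    by (simp add: window_fourier_ivl)
  then show "\<forall>\<^sub>F n in sequentially. abs_L2 (window_fourier n (ivl_L2 a b)) = abs_L2 (fourier_integral (indicator {a..b}))"
    unfolding eventually_sequentially by blast
qed

lemma cinner_fourier_ivl_eq_double_integral:
  assumes "a \<le> b"
  shows "L2_cinner (fourier (ivl_L2 a b)) (ivl_L2 c d) =
    (LINT \<xi>|lborel. LINT x|lborel. indicator {c..d} \<xi> * indicator {a..b} x * cis (- (x * \<xi>)))
      / complex_of_real (sqrt (2 * pi))"
proof -
  let ?E = "fourier_integral (indicator {a..b})"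
  have [measurable]: "?E \<in> borel_measurable borel" by (rule fourier_integral_ivl_measurable[OF assms])
  have cis_m [measurable]: "(\<lambda>x. cis (- (x * \<xi>))) \<in> borel_measurable borel" for \<xi>
    by (intro borel_measurable_continuous_onI continuous_on_cis continuous_on_minus
        continuous_on_mult continuous_on_id continuous_on_const)
  have "L2_cinner (fourier (ivl_L2 a b)) (ivl_L2 c d) = (LINT \<xi>|lebesgue. ?E \<xi> * cnj (indicator {c..d} \<xi>))"
    unfolding fourier_ivl unfolding ivl_L2_def
    by (rule cinner_abs_L2[OF square_integrable_fourier_integral_ivl[OF assms] square_integrable_indicator_ivl])
  also have "(\<lambda>\<xi>. ?E \<xi> * cnj (indicator {c..d} \<xi>)) = (\<lambda>\<xi>. indicator {c..d} \<xi> * ?E \<xi>)"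
    by (auto simp: indicator_def fun_eq_iff)
  also have "(LINT \<xi>|lebesgue. indicator {c..d} \<xi> * ?E \<xi>) = (LINT \<xi>|lborel. indicator {c..d} \<xi> * ?E \<xi>)"
    by (rule integral_completion) measurable
  also have "\<dots> = (LINT \<xi>|lborel. (LINT x|lborel. indicator {c..d} \<xi> * indicator {a..b} x * cis (- (x * \<xi>)))
      / complex_of_real (sqrt (2 * pi)))"
  proof -
    have "?E \<xi> = (LINT x|lborel. indicator {a..b} x * cis (- (x * \<xi>))) / complex_of_real (sqrt (2 * pi))" for \<xi>
      unfolding fourier_integral_def by (subst integral_completion) measurable
    then show ?thesis by (simp add: mult.assoc)
  qed
  finally show ?thesis by simp
qed

lemma cinner_fourier_ivl_commute:
  assumes "a \<le> b" "c \<le> d"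
  shows "L2_cinner (fourier (ivl_L2 a b)) (ivl_L2 c d) = L2_cinner (fourier (ivl_L2 c d)) (ivl_L2 a b)"
proof -
  let ?k = "\<lambda>x \<xi>. indicator {c..d} \<xi> * indicator {a..b} x * cis (- (x * \<xi>)) :: complex"
  have "continuous_on ({a..b} \<times> {c..d}) (\<lambda>z. cis (- (fst z * snd z)))"
    by (intro continuous_on_cis continuous_on_minus continuous_on_mult continuous_on_fst
        continuous_on_snd continuous_on_id)
  then have "integrable lborel (\<lambda>z. indicator ({a..b} \<times> {c..d}) z *\<^sub>R cis (- (fst z * snd z)))"
    by (intro borel_integrable_compact compact_Times) auto
  also have "(\<lambda>z. indicator ({a..b} \<times> {c..d}) z *\<^sub>R cis (- (fst z * snd z))) = case_prod ?k"
    by (auto simp: fun_eq_iff indicator_def)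
  finally have "integrable (lborel \<Otimes>\<^sub>M lborel) (case_prod ?k)" by (simp only: lborel_prod)
  then have "(LINT \<xi>|lborel. LINT x|lborel. ?k x \<xi>) = (LINT x|lborel. LINT \<xi>|lborel. ?k x \<xi>)"
    by (rule lborel_pair.Fubini_integral)
  then show ?thesis
    using assms by (simp add: cinner_fourier_ivl_eq_double_integral mult_ac)
qed

text \<open>Since \<open>L2_cinner f (L2_conj g)\<close> is the integral of \<open>f * g\<close>, this is the classical formula that the
Fourier transform may be moved from one factor of a product to the other under the integral. On
intervals it is Fubini's theorem for the symmetric kernel \<open>cis (- (x * \<xi>))\<close>.\<close>

lemma fourier_multiplication_formula:
  "L2_cinner (fourier f) (L2_conj g) = L2_cinner (fourier g) (L2_conj f)"
proof -
  have left_ivl: "L2_cinner (fourier f) (L2_conj (c *\<^sub>C ivl_L2 a b)) = L2_cinner (fourier (c *\<^sub>C ivl_L2 a b)) (L2_conj f)"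
    if "a \<le> b" for c a b
  proof (induction f rule: L2_step_induct)
    case (ivl d a' b')
    show ?case
      using cinner_fourier_ivl_commute[OF ivl \<open>a \<le> b\<close>]
      by (simp add: fourier_scaleC L2_conj_scaleC L2_conj_ivl L2_cinner_scaleC_left L2_cinner_scaleC_right)
  next
    case (add f g)
    then show ?case
      by (simp add: fourier_add L2_conj_add L2_cinner_add_left L2_cinner_add_right)
  next
    case (limit X f)
    have "(\<lambda>n. L2_cinner (fourier (X n)) (L2_conj (c *\<^sub>C ivl_L2 a b)))
        \<longlonglongrightarrow> L2_cinner (fourier f) (L2_conj (c *\<^sub>C ivl_L2 a b))"
      by (intro tendsto_intros tendsto_fourier limit)
    moreover have "(\<lambda>n. L2_cinner (fourier (c *\<^sub>C ivl_L2 a b)) (L2_conj (X n)))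
        \<longlonglongrightarrow> L2_cinner (fourier (c *\<^sub>C ivl_L2 a b)) (L2_conj f)"
      by (intro tendsto_intros tendsto_L2_conj limit)
    ultimately show ?case unfolding limit(1) by (rule LIMSEQ_unique)
  qed
  show ?thesis
  proof (induction g rule: L2_step_induct)
    case (ivl c a b)
    then show ?case by (rule left_ivl)
  next
    case (add g h)
    then show ?case
      by (simp add: fourier_add L2_conj_add L2_cinner_add_left L2_cinner_add_right)
  next
    case (limit X g)
    have "(\<lambda>n. L2_cinner (fourier f) (L2_conj (X n))) \<longlonglongrightarrow> L2_cinner (fourier f) (L2_conj g)"
      by (intro tendsto_intros tendsto_L2_conj limit)
    moreover have "(\<lambda>n. L2_cinner (fourier (X n)) (L2_conj f)) \<longlonglongrightarrow> L2_cinner (fourier g) (L2_conj f)"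
      by (intro tendsto_intros tendsto_fourier limit)
    ultimately show ?case unfolding limit(1) by (rule LIMSEQ_unique)
  qed
qed

text \<open>The adjoint is the Fourier transform conjugated by complex conjugation, that is, the Fourier integral
with the opposite sign in the exponent. In particular it is isometric as well.\<close>

lemma fourier_adjoint_eq: "L2_adjoint fourier g = L2_conj (fourier (L2_conj g))"
  unfolding L2_adjoint_def
proof (rule the_equality)
  show *: "\<forall>f. L2_cinner (fourier f) g = L2_cinner f (L2_conj (fourier (L2_conj g)))"
    using fourier_multiplication_formula[of _ "L2_conj g"] cinner_conj_right by simp
  show "h = L2_conj (fourier (L2_conj g))" if "\<forall>f. L2_cinner (fourier f) g = L2_cinner f h" for h
    by (rule L2_eqI) (use that * in simp)
qed

lemma cinner_fourier_adjoint: "L2_cinner (fourier f) g = L2_cinner f (L2_adjoint fourier g)"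
  using fourier_multiplication_formula[of f "L2_conj g"] cinner_conj_right[of "fourier (L2_conj g)" f]
  by (simp add: fourier_adjoint_eq)

text \<open>Surjectivity of the Fourier transform, without an inversion formula: the adjoint \<open>A\<close> is isometric, so that
\<open>L2_cinner (fourier (A g)) h = L2_cinner (A g) (A h) = L2_cinner g h\<close>.\<close>

lemma fourier_fourier_adjoint: "fourier (L2_adjoint fourier g) = g"
proof (rule L2_eqI)
  fix h
  have "L2_cinner h (fourier (L2_adjoint fourier g)) = cnj (L2_cinner (fourier (L2_adjoint fourier g)) h)"
    by (rule L2_cinner_commute)
  also have "\<dots> = cnj (L2_cinner (L2_adjoint fourier g) (L2_adjoint fourier h))"
    by (simp only: cinner_fourier_adjoint)
  also have "\<dots> = cnj (L2_cinner g h)"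
    by (simp add: fourier_adjoint_eq cinner_conj_conj cinner_fourier)
  also have "\<dots> = L2_cinner h g" by (rule L2_cinner_commute[symmetric])
  finally show "L2_cinner h (fourier (L2_adjoint fourier g)) = L2_cinner h g" .
qed

lemma freq_proj_selfadjoint:
  assumes "\<Sigma> \<in> sets lebesgue"
  shows "L2_cinner (freq_proj \<Sigma> f) g = L2_cinner f (freq_proj \<Sigma> g)"
proof -
  have eq: "freq_proj \<Sigma> f = L2_adjoint fourier (time_proj \<Sigma> (fourier f))" for f
    by (simp add: freq_proj_def time_proj_def)
  have "L2_cinner (freq_proj \<Sigma> f) g = cnj (L2_cinner g (freq_proj \<Sigma> f))" by (rule L2_cinner_commute)
  also have "\<dots> = cnj (L2_cinner (fourier g) (time_proj \<Sigma> (fourier f)))"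
    by (simp add: eq cinner_fourier_adjoint)
  also have "\<dots> = L2_cinner (time_proj \<Sigma> (fourier f)) (fourier g)" by (rule L2_cinner_commute[symmetric])
  also have "\<dots> = L2_cinner f (freq_proj \<Sigma> g)"
    by (simp add: eq time_proj_selfadjoint[OF assms] cinner_fourier_adjoint)
  finally show ?thesis .
qed

text \<open>Here surjectivity matters: \<open>fourier\<close> following its adjoint has to cancel between two
copies of the multiplication operator.\<close>

lemma freq_proj_idem:
  assumes "\<Sigma> \<in> sets lebesgue" shows "freq_proj \<Sigma> (freq_proj \<Sigma> f) = freq_proj \<Sigma> f"
  using time_proj_Int[OF assms assms] by (simp add: freq_proj_def time_proj_def fourier_fourier_adjoint)

section \<open>Numerical ranges of pairs of orthogonal projections\<close>

text \<open>Linearity follows from self-adjointness, since vectors are determined by their inner products.\<close>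

locale projection =
  fixes P :: "L2 \<Rightarrow> L2"
  assumes selfadjoint: "L2_cinner (P f) g = L2_cinner f (P g)"
    and idem: "P (P f) = P f"
begin

lemma norm_le: "norm (P f) \<le> norm f"
  by (rule norm_projection_le) (rule selfadjoint idem)+

lemma scaleC: "P (c *\<^sub>C f) = c *\<^sub>C P f"
  by (rule L2_eqI) (simp add: selfadjoint[symmetric] L2_cinner_scaleC_right)

lemma zero: "P 0 = 0" using norm_le[of 0] by simp

lemma cinner_self: "L2_cinner (P f) f = complex_of_real ((norm (P f))\<^sup>2)"
  by (simp only: L2_cinner_norm[symmetric] selfadjoint idem)

lemma range_iff: "f \<in> range P \<longleftrightarrow> P f = f"
  using idem by (metis rangeE rangeI)

lemma fixed_iff_norm: "P f = f \<longleftrightarrow> norm (P f) = norm f"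
proof
  assume *: "norm (P f) = norm f"
  have "L2_cinner (f - P f) (f - P f) = L2_cinner f f - L2_cinner (P f) (P f)"
    by (simp add: L2_cinner_minus_left L2_cinner_minus_right selfadjoint idem)
  also have "\<dots> = 0" by (simp add: L2_cinner_norm *)
  finally show "P f = f" by (simp add: L2_cinner_norm)
qed simp

end

context
  fixes P Q :: "L2 \<Rightarrow> L2"
  assumes P: "projection P" and Q: "projection Q"
begin

lemma unit_fixed_iff: "(\<exists>f. norm f = 1 \<and> P f = f \<and> Q f = f) \<longleftrightarrow> (\<exists>f. f \<noteq> 0 \<and> P f = f \<and> Q f = f)"
proof
  assume "\<exists>f. f \<noteq> 0 \<and> P f = f \<and> Q f = f"
  then obtain f where f: "f \<noteq> 0" "P f = f" "Q f = f" by blast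
  let ?g = "complex_of_real (inverse (norm f)) *\<^sub>C f"
  have "norm ?g = 1" using f(1) by (simp add: norm_L2_scaleC norm_inverse)
  moreover have "P ?g = ?g" "Q ?g = ?g"
    by (simp_all only: projection.scaleC[OF P] projection.scaleC[OF Q] f)
  ultimately show "\<exists>f. norm f = 1 \<and> P f = f \<and> Q f = f" by blast
next
  assume "\<exists>f. norm f = 1 \<and> P f = f \<and> Q f = f"
  then show "\<exists>f. f \<noteq> 0 \<and> P f = f \<and> Q f = f" by (metis norm_zero zero_neq_one)
qed

text \<open>The real and imaginary parts of the quadratic form are the squared lengths of \<open>P f\<close> and \<open>Q f\<close>.
A projection that preserves the length of a vector fixes it.\<close>

lemma numerical_range_sum_iff:
  "1 + \<i> \<in> numerical_range (\<lambda>f. P f + \<i> *\<^sub>C Q f) \<longleftrightarrow> (\<exists>f. norm f = 1 \<and> P f = f \<and> Q f = f)"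
proof -
  have "1 + \<i> = L2_cinner (P f + \<i> *\<^sub>C Q f) f \<longleftrightarrow> P f = f \<and> Q f = f" if "norm f = 1" for f
  proof -
    have "L2_cinner (P f + \<i> *\<^sub>C Q f) f = Complex ((norm (P f))\<^sup>2) ((norm (Q f))\<^sup>2)"
      by (simp add: L2_cinner_add_left L2_cinner_scaleC_left projection.cinner_self P Q complex_eq_iff
          del: of_real_power)
    moreover have "1 + \<i> = Complex 1 1" by (simp add: complex_eq_iff)
    ultimately show ?thesis
      using that by (auto simp: projection.fixed_iff_norm P Q power2_eq_1_iff
          dest: order_trans[OF norm_ge_zero eq_refl])
  qed
  then show ?thesis unfolding numerical_range_def by blast
qed

text \<open>The quadratic form is \<open>L2_cinner (Q f) (P f)\<close>. By Cauchy--Schwarz the value \<open>1\<close> forces both factors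
to have the full length \<open>1\<close>.\<close>

lemma numerical_range_comp_iff:
  "1 \<in> numerical_range (P \<circ> Q) \<longleftrightarrow> (\<exists>f. norm f = 1 \<and> P f = f \<and> Q f = f)"
proof -
  have "1 = L2_cinner ((P \<circ> Q) f) f \<longleftrightarrow> P f = f \<and> Q f = f" if f: "norm f = 1" for f
  proof
    assume "1 = L2_cinner ((P \<circ> Q) f) f"
    then have "1 = Re (L2_cinner (Q f) (P f))" by (simp add: projection.selfadjoint[OF P] complex_eq_iff)
    also have "\<dots> \<le> norm (Q f) * norm (P f)"
      unfolding inner_L2_def[symmetric] by (rule norm_cauchy_schwarz)
    finally have prod: "1 \<le> norm (Q f) * norm (P f)" .
    have le: "norm (P f) \<le> 1" "norm (Q f) \<le> 1"
      using projection.norm_le[OF P, of f] projection.norm_le[OF Q, of f] f by auto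
    have "norm (Q f) * norm (P f) \<le> norm (P f)" "norm (Q f) * norm (P f) \<le> norm (Q f)"
      using le by (simp_all add: mult_left_le_one_le mult_right_le_one_le)
    with prod le have "norm (P f) = 1" "norm (Q f) = 1" by linarith+
    then show "P f = f \<and> Q f = f" by (simp add: projection.fixed_iff_norm P Q f)
  next
    assume "P f = f \<and> Q f = f"
    then show "1 = L2_cinner ((P \<circ> Q) f) f" by (simp add: L2_cinner_norm f)
  qed
  then show ?thesis unfolding numerical_range_def by blast
qed

lemma range_Int_iff: "range P \<inter> range Q = {0} \<longleftrightarrow> (\<forall>f. P f = f \<and> Q f = f \<longrightarrow> f = 0)"
  by (auto simp: projection.range_iff[OF P] projection.range_iff[OF Q] projection.zero[OF P]
      projection.zero[OF Q] set_eq_iff)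

end

theorem proposition5p9:
  fixes S \<Sigma> :: "real set"
  assumes "S \<in> sets lebesgue" and "\<Sigma> \<in> sets lebesgue"
  shows "(annihilating_pair S \<Sigma> \<longleftrightarrow>
            1 + \<i> \<notin> numerical_range (\<lambda>f. time_proj S f + \<i> *\<^sub>C freq_proj \<Sigma> f))
       \<and> (annihilating_pair S \<Sigma> \<longleftrightarrow>
            range (time_proj S) \<inter> range (freq_proj \<Sigma>) = {0})
       \<and> (annihilating_pair S \<Sigma> \<longleftrightarrow>
            1 \<notin> numerical_range (time_proj S \<circ> freq_proj \<Sigma>))"
proof -
  have P: "projection (time_proj S)"
    using assms by unfold_locales (simp_all add: time_proj_selfadjoint time_proj_idem)
  have Q: "projection (freq_proj \<Sigma>)"
    using assms by unfold_locales (simp_all add: freq_proj_selfadjoint freq_proj_idem)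
  show ?thesis
    unfolding annihilating_pair_def numerical_range_sum_iff[OF P Q] numerical_range_comp_iff[OF P Q]
      range_Int_iff[OF P Q] unit_fixed_iff[OF P Q]
    by blast
qed

end
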